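(* Let $n\ge 2$, let $\mathfrak g_n$ be a simple complex Lie algebra of type $B_n$ and let $\mathfrak b_n$ be a Borel subalgebra of $\mathfrak g_n$. Then there is a one-to-one correspondence (bijection) between the set of all ad-nilpotent ideals of $\mathfrak b_n$ and the set of all $B_n$-paths.
   Context: An ideal $\mathfrak i$ of $\mathfrak b_n$ is called ad-nilpotent if the adjoint action on $\mathfrak b_n$ of each element of $\mathfrak i$ is nilpotent. A $B_n$-path is a word of length $2n$ on the alphabet $\{r,f\}$ such that each prefix of the word contains at least as many $r$'s as $f$'s. *)

theory Defs
  imports
    "Jordan_Normal_Form.Matrix"
    "HOL-Library.Sublist"
    Complex_Main
begin

locale complex_lie_algebra = vector_space scale
  for scale :: "complex \<Rightarrow> 'a::ab_group_add \<Rightarrow> 'a" +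
  fixes br :: "'a \<Rightarrow> 'a \<Rightarrow> 'a"
  assumes br_add_left: "br (x + y) z = br x z + br y z"
    and br_add_right: "br x (y + z) = br x y + br x z"
    and br_scale_left: "br (scale c x) y = scale c (br x y)"
    and br_scale_right: "br x (scale c y) = scale c (br x y)"
    and br_self: "br x x = 0"
    and jacobi: "br x (br y z) + br y (br z x) + br z (br x y) = 0"
begin

definition subalgebra :: "'a set \<Rightarrow> bool" where
  "subalgebra S \<longleftrightarrow> subspace S \<and> (\<forall>x\<in>S. \<forall>y\<in>S. br x y \<in> S)"

definition lie_ideal :: "'a set \<Rightarrow> 'a set \<Rightarrow> bool" where
  "lie_ideal I S \<longleftrightarrow> subspace I \<and> I \<subseteq> S \<and> (\<forall>x\<in>S. \<forall>y\<in>I. br x y \<in> I)"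

definition simple_lie :: bool where
  "simple_lie \<longleftrightarrow>
     (\<exists>x y. br x y \<noteq> 0) \<and> (\<forall>I. lie_ideal I UNIV \<longrightarrow> I = {0} \<or> I = UNIV)"

fun derived_series :: "'a set \<Rightarrow> nat \<Rightarrow> 'a set" where
  "derived_series S 0 = S"
| "derived_series S (Suc k) =
     span {br x y | x y. x \<in> derived_series S k \<and> y \<in> derived_series S k}"

definition solvable_subalgebra :: "'a set \<Rightarrow> bool" where
  "solvable_subalgebra S \<longleftrightarrow> subalgebra S \<and> (\<exists>k. derived_series S k = {0})"

definition borel_subalgebra :: "'a set \<Rightarrow> bool" where
  "borel_subalgebra b \<longleftrightarrow>
     solvable_subalgebra b \<and> (\<forall>S. solvable_subalgebra S \<and> b \<subseteq> S \<longrightarrow> S = b)"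

definition ad_nilpotent_ideal :: "'a set \<Rightarrow> 'a set \<Rightarrow> bool" where
  "ad_nilpotent_ideal I b \<longleftrightarrow>
     lie_ideal I b \<and> (\<forall>x\<in>I. \<exists>k. \<forall>y\<in>b. (br x ^^ k) y = 0)"

end

definition so :: "nat \<Rightarrow> complex mat set" where
  "so m = {A \<in> carrier_mat m m. transpose_mat A = - A}"

text \<open>
  ``Type \<open>B\<^sub>n\<close>'' is read as: isomorphic to the classical Lie algebra \<open>so(2n + 1, \<complex>)\<close>,
  the algebra of skew-symmetric complex matrices of size \<open>2n + 1\<close> with the commutator bracket.
  This is independent of the chosen nondegenerate symmetric bilinear form, since all such forms
  of a given dimension are equivalent over \<open>\<complex>\<close>. Finite-dimensionality is part of the notion.
\<close>

definition (in complex_lie_algebra) type_B :: "nat \<Rightarrow> bool" where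
  "type_B n \<longleftrightarrow>
     (\<exists>\<phi>. bij_betw \<phi> UNIV (so (2 * n + 1)) \<and>
          (\<forall>x y. \<phi> (x + y) = \<phi> x + \<phi> y) \<and>
          (\<forall>c x. \<phi> (scale c x) = c \<cdot>\<^sub>m \<phi> x) \<and>
          (\<forall>x y. \<phi> (br x y) = \<phi> x * \<phi> y - \<phi> y * \<phi> x))"

datatype letter = R | F

definition B_paths :: "nat \<Rightarrow> letter list set" where
  "B_paths n =
     {w. length w = 2 * n \<and> (\<forall>u. prefix u w \<longrightarrow> count_list u F \<le> count_list u R)}"

end

(*
  By Lie's theorem a Borel subalgebra b of so(2n+1) stabilises a flag of isotropic subspaces;
  it is completed to a basis in which the form is antidiagonal, and by maximality b consists of all
  upper triangular matrices of the algebra. Root vectors are then indexed by the pairs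
  i < j with i + j < 2n. An ideal is ad-nilpotent iff it has no Cartan part; since distinct
  positive roots are separated by the Cartan subalgebra, such an ideal is spanned by the root
  vectors it contains, whose index pairs form a set closed under decreasing i and j.
  On each diagonal j - i = d such a set is an initial segment, and its length grows by 0 or 1
  when d decreases by 1: recording these increments as the letters R and F gives a B_n-path.
*)
theory Submission
  imports
    Defs
    "HOL-Computational_Algebra.Fundamental_Theorem_Algebra"
    "HOL-Library.Function_Algebras"
    "Jordan_Normal_Form.Determinant"
begin

section \<open>Lie's theorem\<close>

text \<open>Quotient spaces are avoided: for nested invariant subspaces, eigenvectors, weights and
  commutators are taken in \<open>W\<close> modulo \<open>U\<close>, so that Lie's theorem serves
  every step of a flag directly. The delicate point of the flag is isotropy. A common eigenvector in
  \<open>perp\<close> modulo \<open>U\<close> may be anisotropic; skewness then forces its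
  eigenvalues to be zero, and a second such vector orthogonal to it combines with it into an
  isotropic one. This needs dimension at least two in \<open>perp\<close> modulo \<open>U\<close>,
  so dimension 2n + 1 allows exactly n steps and leaves an anisotropic line. An element is recorded
  by a skew array of pairings of basis vectors instead of an endomorphism. A positive root is then a
  pair of indices, and lowering one index by 1 adds a simple root. The diagonal j - i = d contains
  floor((2n + 1 - d) / 2) positive roots, which is also the largest number of letters
  \<open>F\<close> in a prefix of length 2n + 1 - d of a path. This is why diagonals are matched
  with prefixes in this way.\<close>

locale complex_vector_space = vector_space vs
  for vs :: "complex \<Rightarrow> 'v::ab_group_add \<Rightarrow> 'v"  (infixr "*s" 75)
begin

abbreviation lin :: "('v \<Rightarrow> 'v) \<Rightarrow> bool" where
  "lin \<equiv> Vector_Spaces.linear (*s) (*s)"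

lemma linI:
  assumes "\<And>v w. T (v + w) = T v + T w" "\<And>c v. T (c *s v) = c *s T v"
  shows "lin T"
  using assms by (unfold_locales) auto

section \<open>Dimension counts and polynomials in one operator\<close>

lemma finite_dimensional_sequence_dependent:
  assumes "finite B" "\<And>i. x i \<in> span B"
  shows "\<exists>m::nat. x m \<in> span (x ` {..<m})"
proof (rule ccontr)
  assume "\<not> ?thesis"
  then have nin: "x m \<notin> span (x ` {..<m})" for m by simp
  have ind: "independent (x ` {..<m}) \<and> card (x ` {..<m}) = m" for m
  proof (induction m)
    case (Suc m)
    have "x m \<notin> x ` {..<m}" using span_base[of "x m" "x ` {..<m}"] nin[of m] by metis
    then show ?case using nin[of m] Suc by (simp add: lessThan_Suc independent_insert)
  qed (simp add: independent_empty)
  have "card (x ` {..<Suc (card B)}) \<le> card B"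
    using independent_span_bound[OF assms(1), of "x ` {..<Suc (card B)}"]
      ind[of "Suc (card B)"] assms(2) by blast
  then show False using ind[of "Suc (card B)"] by linarith
qed

lemma dim_strict_mono:
  assumes "subspace E" "subspace W" "E \<subset> W" "finite B" "W \<subseteq> span B"
  shows "dim E < dim W"
proof -
  obtain C where C: "C \<subseteq> E" "independent C" "E \<subseteq> span C"
    using maximal_independent_subset_extend[of "{}" E] independent_empty by auto
  obtain D where D: "C \<subseteq> D" "D \<subseteq> W" "independent D" "W \<subseteq> span D"
    using maximal_independent_subset_extend[of C W] C assms(3) by blast
  have "span C \<subseteq> E" using C(1) assms(1) by (rule span_minimal)
  then have "C \<noteq> D" using D(4) assms(3) by blast
  moreover have "finite D" using independent_span_bound[OF assms(4) D(3)] D(2) assms(5) by blast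
  ultimately have "card C < card D" using D(1) by (simp add: psubset_card_mono psubsetI)
  then show ?thesis using basis_card_eq_dim C D by metis
qed

text \<open>This is p(T) v, computed by Horner's scheme.\<close>

definition poly_act :: "('v \<Rightarrow> 'v) \<Rightarrow> complex poly \<Rightarrow> 'v \<Rightarrow> 'v" where
  "poly_act T p = fold_coeffs (\<lambda>a f v. a *s v + T (f v)) p (\<lambda>_. 0)"

lemma poly_act_0 [simp]: "poly_act T 0 v = 0"
  by (simp add: poly_act_def)

context
  fixes T :: "'v \<Rightarrow> 'v"
  assumes lin_T: "lin T"
begin

interpretation T: Vector_Spaces.linear "(*s)" "(*s)" T by (rule lin_T)

lemma poly_act_pCons [simp]: "poly_act T (pCons a p) v = a *s v + T (poly_act T p v)"
  by (cases "a = 0 \<and> p = 0") (auto simp: poly_act_def T.zero)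

lemma poly_act_add: "poly_act T (p + q) v = poly_act T p v + poly_act T q v"
  by (induction p q rule: poly_induct2) (simp_all add: T.add scale_left_distrib)

lemma poly_act_smult: "poly_act T (smult c p) v = c *s poly_act T p v"
  by (induction p) (simp_all add: T.scale scale_right_distrib)

lemma poly_act_monom: "poly_act T (monom 1 i) v = (T ^^ i) v"
  by (induction i) (simp_all add: monom_0 monom_Suc T.zero)

lemma poly_act_mem:
  assumes "subspace W" "\<And>w. w \<in> W \<Longrightarrow> T w \<in> W" "w \<in> W"
  shows "poly_act T p w \<in> W"
  by (induction p) (auto intro!: subspace_add subspace_scale subspace_0 assms)

lemma poly_act_span: "v \<in> span ((\<lambda>i. (T ^^ i) w) ` {..<m}) \<Longrightarrow>
    \<exists>p. (\<forall>i\<ge>m. coeff p i = 0) \<and> v = poly_act T p w"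
proof (induction rule: span_induct_alt)
  case base
  then show ?case by (intro exI[of _ 0]) simp
next
  case (step c x y)
  then obtain i p where "i < m" "x = (T ^^ i) w" "\<forall>i\<ge>m. coeff p i = 0" "y = poly_act T p w" by blast
  then show ?case
    by (intro exI[of _ "smult c (monom 1 i) + p"])
      (auto simp: poly_act_add poly_act_smult poly_act_monom[symmetric])
qed

lemma annihilating_poly:
  assumes "finite B" "W \<subseteq> span B" "\<And>w. w \<in> W \<Longrightarrow> T w \<in> W" "w \<in> W"
  shows "\<exists>p. p \<noteq> 0 \<and> poly_act T p w = 0"
proof -
  have "(T ^^ i) w \<in> W" for i by (induction i) (auto simp: assms)
  then obtain m where "(T ^^ m) w \<in> span ((\<lambda>i. (T ^^ i) w) ` {..<m})"
    using finite_dimensional_sequence_dependent[of B "\<lambda>i. (T ^^ i) w"] assms by blast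
  from poly_act_span[OF this] obtain p
    where p: "\<forall>i\<ge>m. coeff p i = 0" "(T ^^ m) w = poly_act T p w" by blast
  have "coeff (monom 1 m + smult (-1) p) m = 1" using p(1) by simp
  then have "monom 1 m + smult (-1) p \<noteq> 0" by (metis coeff_0 zero_neq_one)
  moreover have "poly_act T (monom 1 m + smult (-1) p) w = 0"
    using p(2) by (simp only: poly_act_add poly_act_smult poly_act_monom) simp
  ultimately show ?thesis by blast
qed

text \<open>Among the nonzero polynomials p such that p(T) carries some w of \<open>W - U\<close>
  into \<open>U\<close>, one of least degree is taken and a root c is split off, p = (X - c) q.
  Minimality keeps q(T) w outside \<open>U\<close>, while (T - c) q(T) w lies in
  \<open>U\<close>.\<close>

lemma eigenvector_mod:
  assumes "subspace U" "subspace W" "U \<subset> W" "finite B" "W \<subseteq> span B"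
    and TW: "\<And>w. w \<in> W \<Longrightarrow> T w \<in> W"
  shows "\<exists>w\<in>W - U. \<exists>c. T w - c *s w \<in> U"
proof -
  define good where "good p \<longleftrightarrow> p \<noteq> 0 \<and> (\<exists>w\<in>W - U. poly_act T p w \<in> U)" for p
  obtain w0 where "w0 \<in> W - U" using assms(3) by blast
  then have "\<exists>p. good p"
    using annihilating_poly[OF assms(4,5) TW, of w0] subspace_0[OF assms(1)]
    unfolding good_def by (metis DiffD1)
  then obtain p where "good p" and min: "\<And>q. good q \<Longrightarrow> degree p \<le> degree q"
    using ex_has_least_nat[of good _ degree] by blast
  then obtain w where w: "w \<in> W" "w \<notin> U" "poly_act T p w \<in> U" and "p \<noteq> 0"
    unfolding good_def by blast
  \<comment> \<open>A nonzero constant carries w into \<open>U\<close> only if w is already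
    there.\<close>
  have "degree p \<noteq> 0"
  proof
    assume "degree p = 0"
    then obtain a where a: "p = [:a:]" by (rule degree_eq_zeroE)
    with \<open>p \<noteq> 0\<close> have "a \<noteq> 0" by simp
    have "inverse a *s poly_act T p w \<in> U" using w(3) assms(1) by (simp add: subspace_scale)
    with \<open>a \<noteq> 0\<close> w(2) a show False by (simp add: T.zero)
  qed
  then have "\<not> constant (poly p)" by (simp add: constant_degree)
  then obtain c where "poly p c = 0" using fundamental_theorem_of_algebra by blast
  then obtain q where q: "p = [:-c, 1:] * q" using poly_eq_0_iff_dvd by (metis dvdE)
  with \<open>p \<noteq> 0\<close> have "q \<noteq> 0" by auto
  then have "degree q < degree p" unfolding q by (subst degree_mult_eq) auto
  with min have "\<not> good q" by (meson leD)
  with \<open>q \<noteq> 0\<close> w have "poly_act T q w \<notin> U" unfolding good_def by blast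
  moreover have "poly_act T q w \<in> W" using poly_act_mem assms(2) TW w(1) by blast
  moreover have "poly_act T p w = T (poly_act T q w) - c *s poly_act T q w"
  proof -
    have "p = pCons 0 q + smult (-c) q" unfolding q by simp
    then show ?thesis by (simp only: poly_act_add poly_act_smult poly_act_pCons) simp
  qed
  ultimately show ?thesis using w(3) by auto
qed

end

text \<open>Let \<open>E\<close> be an invariant subspace properly above \<open>U\<close> of least
  dimension. Since the operators commute modulo \<open>U\<close>, an eigenspace of one
  \<open>\<rho> x\<close> in \<open>E\<close> modulo \<open>U\<close> is again of this kind, hence
  equals \<open>E\<close>. So every operator is scalar on \<open>E\<close> modulo \<open>U\<close>,
  and any vector of \<open>E - U\<close> serves for all of them.\<close>

lemma commuting_eigenvector_mod:
  assumes UW: "subspace U" "subspace W" "U \<subset> W" "finite B" "W \<subseteq> span B"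
    and lin: "\<And>x. x \<in> S \<Longrightarrow> lin (\<rho> x)"
    and U: "\<And>x u. x \<in> S \<Longrightarrow> u \<in> U \<Longrightarrow> \<rho> x u \<in> U"
    and W: "\<And>x w. x \<in> S \<Longrightarrow> w \<in> W \<Longrightarrow> \<rho> x w \<in> W"
    and comm: "\<And>x y w. x \<in> S \<Longrightarrow> y \<in> S \<Longrightarrow> w \<in> W \<Longrightarrow> \<rho> x (\<rho> y w) - \<rho> y (\<rho> x w) \<in> U"
  shows "\<exists>w\<in>W - U. \<forall>x\<in>S. \<exists>c. \<rho> x w - c *s w \<in> U"
proof -
  define good where "good E \<longleftrightarrow> subspace E \<and> U \<subset> E \<and> E \<subseteq> W \<and> (\<forall>x\<in>S. \<forall>w\<in>E. \<rho> x w \<in> E)" for E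
  have "good W" using UW W by (auto simp: good_def)
  then obtain E where "good E" and min: "\<And>E'. good E' \<Longrightarrow> dim E \<le> dim E'"
    using ex_has_least_nat[of good _ dim] by blast
  then have E: "subspace E" "U \<subset> E" "E \<subseteq> W" "\<And>x w. x \<in> S \<Longrightarrow> w \<in> E \<Longrightarrow> \<rho> x w \<in> E"
    unfolding good_def by auto
  have scalar: "\<exists>c. \<forall>w\<in>E. \<rho> x w - c *s w \<in> U" if x: "x \<in> S" for x
  proof -
    interpret X: Vector_Spaces.linear "(*s)" "(*s)" "\<rho> x" using lin x by blast
    obtain w0 c where w0: "w0 \<in> E - U" "\<rho> x w0 - c *s w0 \<in> U"
      using eigenvector_mod[OF lin[OF x] UW(1) E(1,2) UW(4)] E(3,4) UW(5) x by blast
    define E' where "E' = {w \<in> E. \<rho> x w - c *s w \<in> U}"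
    have "subspace E'"
      unfolding E'_def
    proof (rule subspaceI)
      show "0 \<in> {w \<in> E. \<rho> x w - c *s w \<in> U}" using E(1) UW(1) by (simp add: subspace_0 X.zero)
    next
      fix v w assume *: "v \<in> {w \<in> E. \<rho> x w - c *s w \<in> U}" "w \<in> {w \<in> E. \<rho> x w - c *s w \<in> U}"
      then have "(\<rho> x v - c *s v) + (\<rho> x w - c *s w) \<in> U" using UW(1) by (simp add: subspace_add)
      then have "\<rho> x (v + w) - c *s (v + w) \<in> U" by (simp add: X.add algebra_simps)
      with * E(1) show "v + w \<in> {w \<in> E. \<rho> x w - c *s w \<in> U}" by (simp add: subspace_add)
    next
      fix d w assume *: "w \<in> {w \<in> E. \<rho> x w - c *s w \<in> U}"
      then have "d *s (\<rho> x w - c *s w) \<in> U" using UW(1) by (simp add: subspace_scale)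
      then have "\<rho> x (d *s w) - c *s d *s w \<in> U"
        by (simp add: X.scale scale_right_diff_distrib mult.commute)
      with * E(1) show "d *s w \<in> {w \<in> E. \<rho> x w - c *s w \<in> U}" by (simp add: subspace_scale)
    qed
    moreover have "\<rho> y w \<in> E'" if "y \<in> S" "w \<in> E'" for y w
    proof -
      interpret Y: Vector_Spaces.linear "(*s)" "(*s)" "\<rho> y" using lin that by blast
      have w: "w \<in> E" "\<rho> x w - c *s w \<in> U" using that(2) by (auto simp: E'_def)
      \<comment> \<open>The sum telescopes to
        \<open>\<rho> x (\<rho> y w) - c *s \<rho> y w\<close>, the condition for
        \<open>\<rho> y w\<close> to lie in \<open>E'\<close>.\<close>
      have "\<rho> y (\<rho> x w - c *s w) + (\<rho> x (\<rho> y w) - \<rho> y (\<rho> x w)) \<in> U"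
        using U[OF that(1) w(2)] comm[OF x that(1)] w(1) E(3) UW(1) by (auto intro!: subspace_add)
      then show ?thesis unfolding E'_def using E(4)[OF that(1) w(1)] by (simp add: Y.diff Y.scale)
    qed
    moreover have "U \<subset> E'"
    proof
      show "U \<subseteq> E'" using E(2) U[OF x] UW(1) by (auto simp: E'_def intro!: subspace_diff subspace_scale)
      show "U \<noteq> E'" using w0 by (auto simp: E'_def)
    qed
    moreover have "E' \<subseteq> E" by (auto simp: E'_def)
    ultimately have "good E'" "subspace E'" "E' \<subseteq> E" using E(3) unfolding good_def by auto
    then have "E' = E" using min dim_strict_mono[OF _ E(1) _ UW(4)] E(3) UW(5) by (meson leD psubsetI subset_trans)
    then show ?thesis unfolding E'_def by blast
  qed
  obtain w where "w \<in> E - U" using E(2) by blast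
  with scalar E(3) show ?thesis by blast
qed

text \<open>If \<open>m\<close> is minimal with \<open>X^m w\<close> in the span of \<open>U\<close> and the lower powers, then applying
  \<open>\<rho> i - \<mu> i\<close> to this dependency and comparing the coefficients of \<open>X^(m-1) w\<close>
  yields \<open>m * \<mu> (D i) = 0\<close>.\<close>

lemma weight_of_bracket_zero:
  assumes UW: "subspace U" "subspace W" "U \<subset> W" "finite B" "W \<subseteq> span B"
    and linX: "lin X" and lin: "\<And>i. i \<in> I \<Longrightarrow> lin (\<rho> i)"
    and XU: "\<And>u. u \<in> U \<Longrightarrow> X u \<in> U" and XW: "\<And>w. w \<in> W \<Longrightarrow> X w \<in> W"
    and U: "\<And>i u. i \<in> I \<Longrightarrow> u \<in> U \<Longrightarrow> \<rho> i u \<in> U"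
    and D: "\<And>i. i \<in> I \<Longrightarrow> D i \<in> I"
    and br: "\<And>i w. i \<in> I \<Longrightarrow> w \<in> W \<Longrightarrow> X (\<rho> i w) - \<rho> i (X w) - \<rho> (D i) w \<in> U"
    and w: "w \<in> W - U" and wt: "\<And>i. i \<in> I \<Longrightarrow> \<rho> i w - \<mu> i *s w \<in> U"
    and i: "i \<in> I"
  shows "\<mu> (D i) = 0"
proof -
  interpret X: Vector_Spaces.linear "(*s)" "(*s)" X by fact
  define x where "x j = (X ^^ j) w" for j
  define L where "L j = span (U \<union> x ` {..<j})" for j
  have xS: "x (Suc j) = X (x j)" and x0: "x 0 = w" for j by (simp_all add: x_def)
  have xW: "x j \<in> W" for j by (induction j) (use w XW in \<open>auto simp: xS x0\<close>)
  have subL: "subspace (L j)" and UL: "U \<subseteq> L j" for j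
    unfolding L_def using span_superset[of "U \<union> x ` {..<j}"] by auto
  have Lmono: "L j \<subseteq> L k" if "j \<le> k" for j k
    unfolding L_def by (rule span_mono) (use that in auto)
  have xL: "x j \<in> L k" if "j < k" for j k
    unfolding L_def by (rule span_base) (use that in auto)
  have XL: "X v \<in> L (Suc j)" if "v \<in> L j" for v j
    using that unfolding L_def
  proof (induction rule: span_induct_alt)
    case base
    then show ?case by (simp add: X.zero span_zero)
  next
    case (step c y z)
    have "X y \<in> span (U \<union> x ` {..<Suc j})"
      by (rule span_base) (use step(1) XU in \<open>auto simp: xS[symmetric]\<close>)
    with step show ?case by (simp add: X.add X.scale span_add span_scale)
  qed
  have LSuc: "\<exists>a. v - a *s x j \<in> L j" if "v \<in> L (Suc j)" for v j
    using that unfolding L_def by (simp add: lessThan_Suc span_insert)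
  \<comment> \<open>Moving \<open>\<rho> i\<close> past the j factors \<open>X\<close> produces
    \<open>\<rho> (D i)\<close> once per factor, whence the coefficient j; iterated \<open>D\<close>
    only affects lower terms. At j = 0 this coefficient removes the term with the truncated index,
    and \<open>L (j - 1)\<close> is then the span of \<open>U\<close>.\<close>
  have key: "\<exists>v\<in>L (j - 1). \<rho> i (x j) = \<mu> i *s x j - (of_nat j * \<mu> (D i)) *s x (j - 1) + v" if "i \<in> I" for i j
    using that
  proof (induction j arbitrary: i)
    case 0
    then show ?case using wt[OF 0] UL by (intro bexI[of _ "\<rho> i w - \<mu> i *s w"]) (auto simp: x0)
  next
    case (Suc j)
    obtain v where v: "v \<in> L (j - 1)"
      "\<rho> i (x j) = \<mu> i *s x j - (of_nat j * \<mu> (D i)) *s x (j - 1) + v" using Suc by blast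
    obtain v' where v': "v' \<in> L (j - 1)"
      "\<rho> (D i) (x j) = \<mu> (D i) *s x j - (of_nat j * \<mu> (D (D i))) *s x (j - 1) + v'"
      using Suc D by blast
    define u where "u = X (\<rho> i (x j)) - \<rho> i (X (x j)) - \<rho> (D i) (x j)"
    have u: "u \<in> U" unfolding u_def using br[OF Suc.prems xW] .
    \<comment> \<open>For j = 0 the index \<open>j - 1\<close> is 0 and the vectors themselves
      differ; the factor 0 saves the equation.\<close>
    have Xj: "of_nat j *s X (x (j - 1)) = of_nat j *s x j" by (cases j) (simp_all add: xS)
    define r where "r = X v + (of_nat j * \<mu> (D (D i))) *s x (j - 1) - v' - u"
    have "(of_nat j * \<mu> (D (D i))) *s x (j - 1) \<in> L j"
      by (cases j) (auto intro!: subspace_scale[OF subL] xL subspace_0[OF subL])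
    moreover have "X v \<in> L j"
    proof (cases j)
      case 0
      then show ?thesis using v(1) XU  by (simp add: L_def span_eq_iff[THEN iffD2, OF UW(1)])
    next
      case (Suc k)
      then show ?thesis using XL[of v k] v(1) by simp
    qed
    moreover have "v' \<in> L j" "u \<in> L j" using v'(1) Lmono[of "j - 1" j] u UL by auto
    ultimately have "r \<in> L j" unfolding r_def by (intro subspace_diff[OF subL] subspace_add[OF subL])
    moreover have "\<rho> i (x (Suc j)) = \<mu> i *s x (Suc j) - (of_nat (Suc j) * \<mu> (D i)) *s x j + r"
    proof -
      have "\<rho> i (x (Suc j)) = X (\<rho> i (x j)) - \<rho> (D i) (x j) - u" by (simp add: u_def xS)
      also have "X (\<rho> i (x j)) = \<mu> i *s x (Suc j) - \<mu> (D i) *s of_nat j *s X (x (j - 1)) + X v"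
        unfolding v(2) by (simp add: X.add X.diff X.scale xS mult.commute)
      also have "\<dots> = \<mu> i *s x (Suc j) - \<mu> (D i) *s of_nat j *s x j + X v" unfolding Xj ..
      finally show ?thesis unfolding v'(2) r_def
        by (simp add: algebra_simps scale_left_distrib mult.commute)
    qed
    ultimately show ?case by auto
  qed
  obtain m where m: "x m \<in> L m" and least: "\<And>k. k < m \<Longrightarrow> x k \<notin> L k"
  proof -
    have "\<exists>m. x m \<in> span (x ` {..<m})"
      using finite_dimensional_sequence_dependent[OF UW(4), of x] xW UW(5) by blast
    then have "\<exists>m. x m \<in> L m" unfolding L_def by (meson Un_upper2 span_mono subsetD)
    then show ?thesis using that exists_least_iff[of "\<lambda>m. x m \<in> L m"] by blast
  qed
  have "m \<noteq> 0"
  proof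
    assume "m = 0"
    with m have "w \<in> U" by (simp add: L_def x0 span_eq_iff[THEN iffD2, OF UW(1)])
    with w show False by blast
  qed
  then obtain k where mk: "m = Suc k" by (cases m) auto
  \<comment> \<open>Modulo its weight, \<open>\<rho> i\<close> lowers the filtration
    \<open>L\<close> by one step: \<open>U\<close> is invariant, and \<open>key\<close> handles each
    \<open>x l\<close>.\<close>
  have low: "\<rho> i v - \<mu> i *s v \<in> L (j - 1)" if "v \<in> L j" for v j
    using that unfolding L_def[of j]
  proof (induction rule: span_induct_alt)
    case base
    interpret Y: Vector_Spaces.linear "(*s)" "(*s)" "\<rho> i" using lin i by blast
    show ?case by (simp add: Y.zero subspace_0[OF subL])
  next
    case (step c y z)
    interpret Y: Vector_Spaces.linear "(*s)" "(*s)" "\<rho> i" using lin i by blast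
    have "\<rho> i y - \<mu> i *s y \<in> L (j - 1)"
    proof (cases "y \<in> U")
      case True
      then have "\<rho> i y - \<mu> i *s y \<in> U" using U[OF i] UW(1) by (auto intro!: subspace_diff subspace_scale)
      then show ?thesis using UL by blast
    next
      case False
      then obtain l where l: "l < j" "y = x l" using step(1) by auto
      obtain v where v: "v \<in> L (l - 1)"
        "\<rho> i (x l) = \<mu> i *s x l - (of_nat l * \<mu> (D i)) *s x (l - 1) + v" using key[OF i] by blast
      have "l - 1 \<le> j - 1" using l(1) by simp
      then have "v \<in> L (j - 1)" using v(1) Lmono by blast
      moreover have "(of_nat l * \<mu> (D i)) *s x (l - 1) \<in> L (j - 1)"
        using l by (cases l) (auto intro!: subspace_scale[OF subL] xL subspace_0[OF subL])
      ultimately have "v - (of_nat l * \<mu> (D i)) *s x (l - 1) \<in> L (j - 1)"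
        by (rule subspace_diff[OF subL])
      then show ?thesis unfolding l(2) v(2) by (simp add: algebra_simps)
    qed
    then have "c *s (\<rho> i y - \<mu> i *s y) + (\<rho> i z - \<mu> i *s z) \<in> L (j - 1)"
      using step by (auto intro!: subspace_add[OF subL] subspace_scale[OF subL])
    then show ?case
      by (simp add: Y.add Y.scale scale_right_diff_distrib scale_right_distrib algebra_simps mult.commute)
  qed
  have "\<rho> i (x m) - \<mu> i *s x m \<in> L k" using low[OF m] mk by simp
  moreover obtain v where v: "v \<in> L k" "\<rho> i (x m) = \<mu> i *s x m - (of_nat m * \<mu> (D i)) *s x k + v"
    using key[OF i, of m] mk by auto
  ultimately have "v - (\<rho> i (x m) - \<mu> i *s x m) \<in> L k"
    using subspace_diff[OF subL] by blast
  then have in_L: "(of_nat m * \<mu> (D i)) *s x k \<in> L k" unfolding v(2) by simp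
  show ?thesis
  proof (rule ccontr)
    assume "\<mu> (D i) \<noteq> 0"
    \<comment> \<open>Characteristic zero enters here: the positive integer m is invertible.\<close>
    then have nz: "of_nat m * \<mu> (D i) \<noteq> 0" using \<open>m \<noteq> 0\<close> by simp
    have "inverse (of_nat m * \<mu> (D i)) *s (of_nat m * \<mu> (D i)) *s x k \<in> L k"
      using in_L by (rule subspace_scale[OF subL])
    moreover have "inverse (of_nat m * \<mu> (D i)) *s (of_nat m * \<mu> (D i)) *s x k = x k" by (subst scale_scale, subst left_inverse[OF nz]) simp
    ultimately show False using least[of k] mk by simp
  qed
qed

end

section \<open>Solvable algebras and their representations\<close>

context complex_lie_algebra
begin

text \<open>The definition extends the series at its end; an induction on the derived length has to
  remove its first step.\<close>

lemma derived_series_Suc: "derived_series S (Suc k) = derived_series (derived_series S 1) k"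
  by (induction k) simp_all

lemma derived_subalgebra:
  assumes "subalgebra S"
  shows "subalgebra (derived_series S 1)" "derived_series S 1 \<subseteq> S"
proof -
  show sub: "derived_series S 1 \<subseteq> S"
  proof -
    have "subspace S" and "{br x y | x y. x \<in> S \<and> y \<in> S} \<subseteq> S" using assms by (auto simp: subalgebra_def)
    then show ?thesis by (simp add: span_minimal)
  qed
  have "br x y \<in> derived_series S 1" if "x \<in> derived_series S 1" "y \<in> derived_series S 1" for x y
    using that sub by (auto intro!: span_base)
  moreover have "subspace (derived_series S 1)" by simp
  ultimately show "subalgebra (derived_series S 1)" by (simp add: subalgebra_def)
qed

end

locale lie_representation = complex_lie_algebra scale br + V: complex_vector_space vs
  for scale :: "complex \<Rightarrow> 'a::ab_group_add \<Rightarrow> 'a" and br :: "'a \<Rightarrow> 'a \<Rightarrow> 'a"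
    and vs :: "complex \<Rightarrow> 'v::ab_group_add \<Rightarrow> 'v"  (infixr "*s" 75) +
  fixes rep :: "'a \<Rightarrow> 'v \<Rightarrow> 'v"
  assumes rep_add: "rep x (v + w) = rep x v + rep x w"
    and rep_scale: "rep x (c *s v) = c *s rep x v"
    and rep_br: "rep (br x y) v = rep x (rep y v) - rep y (rep x v)"
begin

lemma lin_rep: "V.lin (rep x)"
  by (rule V.linI) (simp_all add: rep_add rep_scale)

lemma rep_0_right [simp]: "rep x 0 = 0"
  using rep_scale[of x 0 0] by simp

lemma rep_diff: "rep x (v - w) = rep x v - rep x w"
  using rep_add[of x "v - w" w] by (simp add: algebra_simps)

lemma rep_0_left [simp]: "rep 0 v = 0"
  using rep_br[of 0 0 v] by (simp add: br_self)

text \<open>Induction on the derived length gives a weight \<open>\<mu>\<close> of the derived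
  algebra \<open>S'\<close>. Its weight space \<open>K\<close> modulo \<open>U\<close> is stable
  under \<open>S\<close> because \<open>\<mu>\<close> vanishes on brackets of \<open>S\<close> with
  \<open>S'\<close>. Once \<open>\<mu>\<close> is known to vanish on all brackets of
  \<open>S\<close>, the algebra acts on \<open>K\<close> modulo \<open>U\<close> by commuting
  operators. This replaces the usual descent through ideals of codimension one.\<close>

theorem lie_theorem_mod:
  assumes "subalgebra S" "derived_series S k = {0}"
    and "V.subspace U" "V.subspace W" "U \<subset> W" "finite B" "W \<subseteq> V.span B"
    and "\<And>x u. x \<in> S \<Longrightarrow> u \<in> U \<Longrightarrow> rep x u \<in> U"
    and "\<And>x w. x \<in> S \<Longrightarrow> w \<in> W \<Longrightarrow> rep x w \<in> W"
  shows "\<exists>w\<in>W - U. \<forall>x\<in>S. \<exists>c. rep x w - c *s w \<in> U"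
  using assms
proof (induction k arbitrary: S)
  case 0
  obtain w where "w \<in> W - U" using 0 by blast
  moreover have "rep x w - 0 *s w \<in> U" if "x \<in> S" for x
    using that 0 by (simp add: V.subspace_0)
  ultimately show ?case by blast
next
  case (Suc k)
  note U = Suc.prems(3) and W = Suc.prems(4) and UW = Suc.prems(5)
    and repU = Suc.prems(8) and repW = Suc.prems(9)
  define S' where "S' = derived_series S 1"
  have S': "subalgebra S'" "S' \<subseteq> S" unfolding S'_def using derived_subalgebra Suc.prems(1) by auto
  have br_S': "br x y \<in> S'" if "x \<in> S" "y \<in> S" for x y
    unfolding S'_def using that by (auto intro!: span_base)
  have "derived_series S' k = {0}" using Suc.prems(2) unfolding S'_def derived_series_Suc .
  then have "\<exists>w\<in>W - U. \<forall>y\<in>S'. \<exists>c. rep y w - c *s w \<in> U"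
    by (rule Suc.IH[OF S'(1) _ U W UW Suc.prems(6,7)]) (use S'(2) repU repW in auto)
  then obtain w0 where w0: "w0 \<in> W - U" "\<forall>y\<in>S'. \<exists>c. rep y w0 - c *s w0 \<in> U" ..
  then obtain \<mu> where \<mu>: "\<And>y. y \<in> S' \<Longrightarrow> rep y w0 - \<mu> y *s w0 \<in> U" by metis
  define K where "K = {w \<in> W. \<forall>y\<in>S'. rep y w - \<mu> y *s w \<in> U}"
  have KW: "K \<subseteq> W" and w0K: "w0 \<in> K" using w0 \<mu> by (auto simp: K_def)
  have K: "V.subspace K"
  proof (rule V.subspaceI)
    show "0 \<in> K" using U W by (simp add: K_def V.subspace_0)
  next
    fix v w assume *: "v \<in> K" "w \<in> K"
    have "rep y (v + w) - \<mu> y *s (v + w) \<in> U" if "y \<in> S'" for y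
    proof -
      have "(rep y v - \<mu> y *s v) + (rep y w - \<mu> y *s w) \<in> U"
        using * that U by (auto simp: K_def intro!: V.subspace_add)
      then show ?thesis by (simp add: rep_add algebra_simps V.scale_right_distrib)
    qed
    then show "v + w \<in> K" using * W by (simp add: K_def V.subspace_add)
  next
    fix d w assume *: "w \<in> K"
    have "rep y (d *s w) - \<mu> y *s d *s w \<in> U" if "y \<in> S'" for y
    proof -
      have "d *s (rep y w - \<mu> y *s w) \<in> U"
        using * that U by (auto simp: K_def intro!: V.subspace_scale)
      then show ?thesis by (simp add: rep_scale V.scale_right_diff_distrib mult.commute)
    qed
    then show "d *s w \<in> K" using * W by (simp add: K_def V.subspace_scale)
  qed
  have UK: "U \<subset> K"
    using UW w0 w0K repU S'(2) U by (auto simp: K_def intro!: V.subspace_diff V.subspace_scale)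
  \<comment> \<open>The weight lemma applies with \<open>X\<close> the action of x and
    \<open>D\<close> the map ad x on \<open>S'\<close>.\<close>
  have \<mu>_br: "\<mu> (br x y) = 0" if x: "x \<in> S" and y: "y \<in> S'" for x y
  proof (rule V.weight_of_bracket_zero[where I = S' and D = "br x" and \<rho> = rep and X = "rep x"
        and w = w0 and U = U and W = W and B = B])
    show "V.lin (rep x)" "V.lin (rep i)" for i by (rule lin_rep)+
    show "rep x (rep i w) - rep i (rep x w) - rep (br x i) w \<in> U" for i w
      by (simp add: rep_br V.subspace_0[OF U])
    show "br x i \<in> S'" if "i \<in> S'" for i using that x S'(2) br_S' by blast
    show "rep i w0 - \<mu> i *s w0 \<in> U" if "i \<in> S'" for i using that \<mu> by blast
  qed (use Suc.prems x y S'(2) w0 in auto)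
  have repK: "rep x w \<in> K" if x: "x \<in> S" and w: "w \<in> K" for x w
  proof -
    have "rep y (rep x w) - \<mu> y *s rep x w \<in> U" if y: "y \<in> S'" for y
    proof -
      have "rep x (rep y w - \<mu> y *s w) \<in> U" using w y repU[OF x] by (simp add: K_def)
      moreover have "br x y \<in> S'" using x y S'(2) br_S' by blast
      then have "rep (br x y) w - \<mu> (br x y) *s w \<in> U" using w by (simp add: K_def)
      ultimately have "rep x (rep y w - \<mu> y *s w) - (rep (br x y) w - \<mu> (br x y) *s w) \<in> U"
        using U by (rule V.subspace_diff[rotated])
      then show ?thesis by (simp add: \<mu>_br[OF x y] rep_br rep_diff rep_scale)
    qed
    with w repW[OF x] show ?thesis by (simp add: K_def)
  qed
  have KB: "K \<subseteq> V.span B" using KW Suc.prems(7) by blast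
  text \<open>On \<open>K / U\<close> the commutator \<open>[x, y]\<close> is a scalar; apply \<open>weight_of_bracket_zero\<close> to the
    family \<open>y, [x, y], 0, 0, \<dots>\<close> to see that this scalar vanishes.\<close>
  have \<mu>_comm: "\<mu> (br x y) = 0" if x: "x \<in> S" and y: "y \<in> S" for x y
  proof -
    have "\<exists>w\<in>K - U. \<exists>c. rep y w - c *s w \<in> U"
      by (rule V.eigenvector_mod[OF lin_rep U K UK Suc.prems(6) KB]) (rule repK[OF y])
    then obtain w c where w: "w \<in> K - U" "rep y w - c *s w \<in> U" by auto
    define \<rho> where "\<rho> i v = (if i = 0 then rep y v else if i = 1 then \<mu> (br x y) *s v else 0)"
      for i :: nat and v
    define \<nu> where "\<nu> i = (if i = 0 then c else if i = 1 then \<mu> (br x y) else 0)" for i :: nat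
    have "\<nu> (Suc 0) = 0"
    proof (rule V.weight_of_bracket_zero[where I = UNIV and D = Suc and \<rho> = \<rho> and X = "rep x"
        and w = w and U = U and W = K and B = B])
      show "V.lin (rep x)" by (rule lin_rep)
      show "V.lin (\<rho> i)" for i
        by (rule V.linI) (auto simp: \<rho>_def rep_add rep_scale V.scale_right_distrib mult.commute)
      show "\<rho> i u \<in> U" if "u \<in> U" for i u
        using that repU[OF y] U by (auto simp: \<rho>_def V.subspace_0 V.subspace_scale)
      show "\<rho> i w - \<nu> i *s w \<in> U" for i
        using w(2) U by (auto simp: \<rho>_def \<nu>_def V.subspace_0)
      fix i v assume v: "v \<in> K"
      have "rep (br x y) v - \<mu> (br x y) *s v \<in> U" using v br_S'[OF x y] by (simp add: K_def)
      then show "rep x (\<rho> i v) - \<rho> i (rep x v) - \<rho> (Suc i) v \<in> U"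
        using U by (auto simp: \<rho>_def rep_br rep_scale V.subspace_0)
    qed (use U K UK KB Suc.prems(6) w repU x repK in auto)
    then show ?thesis by (simp add: \<nu>_def)
  qed
  have "rep x (rep y w) - rep y (rep x w) \<in> U" if "x \<in> S" "y \<in> S" "w \<in> K" for x y w
  proof -
    have "rep (br x y) w - \<mu> (br x y) *s w \<in> U" using that br_S' by (simp add: K_def)
    then show ?thesis using that by (simp add: \<mu>_comm rep_br)
  qed
  then have "\<exists>w\<in>K - U. \<forall>x\<in>S. \<exists>c. rep x w - c *s w \<in> U"
    by (intro V.commuting_eigenvector_mod[OF U K UK Suc.prems(6) KB lin_rep])
      (use repU repK in auto)
  then show ?case using KW by blast
qed

end

section \<open>Invariant isotropic flags\<close>

text \<open>The dimension depends on n, so the orthogonal space cannot be a type of its own; it is a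
  subspace \<open>E\<close> of an ambient vector space, and nondegeneracy is required on
  \<open>E\<close> only.\<close>

locale orthogonal_representation = lie_representation scale br vs rep
  for scale :: "complex \<Rightarrow> 'a::ab_group_add \<Rightarrow> 'a" and br :: "'a \<Rightarrow> 'a \<Rightarrow> 'a"
    and vs :: "complex \<Rightarrow> 'v::ab_group_add \<Rightarrow> 'v"  (infixr "*s" 75)
    and rep :: "'a \<Rightarrow> 'v \<Rightarrow> 'v" +
  fixes form :: "'v \<Rightarrow> 'v \<Rightarrow> complex" and E :: "'v set"
  assumes form_add: "form (u + v) w = form u w + form v w"
    and form_scale: "form (c *s v) w = c * form v w"
    and form_sym: "form v w = form w v"
    and form_rep: "form (rep x v) w = - form v (rep x w)"
    and subspace_E: "V.subspace E"
    and rep_E: "v \<in> E \<Longrightarrow> rep x v \<in> E"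
    and nondegenerate: "v \<in> E \<Longrightarrow> v \<noteq> 0 \<Longrightarrow> \<exists>w\<in>E. form v w \<noteq> 0"
    and finite_dim_E: "\<exists>B. finite B \<and> E \<subseteq> V.span B"
begin

section \<open>Hyperbolic pairs and orthogonal projection\<close>

lemma form_add_right: "form w (u + v) = form w u + form w v"
  by (metis form_add form_sym)

lemma form_scale_right: "form w (c *s v) = c * form w v"
  by (metis form_scale form_sym)

lemma form_0_left [simp]: "form 0 w = 0"
  using form_scale[of 0 0 w] by simp

lemma form_0_right [simp]: "form w 0 = 0"
  using form_sym[of w 0] by simp

lemma form_diff: "form (u - v) w = form u w - form v w"
  using form_add[of "u - v" v w] by (simp add: algebra_simps)

lemma form_diff_right: "form w (u - v) = form w u - form w v"
  by (metis form_diff form_sym)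

lemma form_sum: "form (\<Sum>i\<in>A. g i) w = (\<Sum>i\<in>A. form (g i) w)"
  by (induction A rule: infinite_finite_induct) (simp_all add: form_add)

lemma form_sum_right: "form w (\<Sum>i\<in>A. g i) = (\<Sum>i\<in>A. form w (g i))"
  by (induction A rule: infinite_finite_induct) (simp_all add: form_add_right)

lemmas form_simps = form_add form_add_right form_scale form_scale_right form_diff form_diff_right
  form_sum form_sum_right

lemma form_span_zero:
  assumes "\<And>u. u \<in> A \<Longrightarrow> form w u = 0" "v \<in> V.span A"
  shows "form w v = 0"
  using assms(2) by (induction rule: V.span_induct_alt) (simp_all add: form_simps assms(1))

lemma form_rep_self: "form (rep x v) v = 0"
  using form_rep[of x v v] form_sym[of v "rep x v"] by simp

text \<open>Pairing with \<open>g' m\<close> kills the span of the earlier vectors but not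
  \<open>g m\<close>. This bounds the number of hyperbolic pairs and also gives the dimension of the
  coordinate space.\<close>

lemma dual_family_independent:
  assumes "\<And>i j. i < m \<Longrightarrow> j < m \<Longrightarrow> form (g i) (g' j) = of_bool (i = j)"
  shows "V.independent (g ` {..<m}) \<and> card (g ` {..<m}) = m"
  using assms
proof (induction m)
  case (Suc m)
  have "form (g' m) u = 0" if u: "u \<in> g ` {..<m}" for u
  proof -
    obtain i where "i < m" "u = g i" using u by auto
    then show ?thesis using Suc.prems[of i m] form_sym[of "g' m" u] by simp
  qed
  then have zero: "form (g' m) v = 0" if "v \<in> V.span (g ` {..<m})" for v
    using form_span_zero that by metis
  have "form (g' m) (g m) = 1" using Suc.prems[of m m] form_sym by simp
  then have "g m \<notin> V.span (g ` {..<m})" using zero by force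
  moreover from this have "g m \<notin> g ` {..<m}" using V.span_base by metis
  ultimately show ?case using Suc by (simp add: lessThan_Suc V.independent_insert)
qed (simp add: V.independent_empty)

lemma dual_family_card_le:
  assumes "\<And>i j. i < m \<Longrightarrow> j < m \<Longrightarrow> form (g i) (g' j) = of_bool (i = j)"
    and "\<And>i. i < m \<Longrightarrow> g i \<in> E"
  shows "m \<le> V.dim E"
proof -
  obtain D where D: "D \<subseteq> E" "V.independent D" "E \<subseteq> V.span D" "card D = V.dim E"
    by (rule V.basis_exists)
  obtain B where "finite B" "E \<subseteq> V.span B" using finite_dim_E by auto
  then have "finite D" using V.independent_span_bound[of B D] D by auto
  moreover have "g ` {..<m} \<subseteq> V.span D" using assms(2) D(3) by auto
  moreover note dual_family_independent[of m g g'] assms(1)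
  ultimately show ?thesis using V.independent_span_bound[of D "g ` {..<m}"] D(4) by auto
qed

text \<open>The pairs span k mutually orthogonal hyperbolic planes; \<open>e\<close> carries the
  isotropic flag and \<open>f\<close> is the dual isotropic family.\<close>

definition hyperbolic :: "nat \<Rightarrow> (nat \<Rightarrow> 'v) \<Rightarrow> (nat \<Rightarrow> 'v) \<Rightarrow> bool" where
  "hyperbolic k e f \<longleftrightarrow> (\<forall>i<k. e i \<in> E \<and> f i \<in> E \<and> (\<forall>j<k. form (e i) (e j) = 0 \<and>
     form (f i) (f j) = 0 \<and> form (e i) (f j) = of_bool (i = j)))"

lemma hyperbolicD:
  assumes "hyperbolic k e f" "i < k"
  shows "e i \<in> E" "f i \<in> E"
    and "j < k \<Longrightarrow> form (e i) (e j) = 0" "j < k \<Longrightarrow> form (f i) (f j) = 0"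
    and "j < k \<Longrightarrow> form (e i) (f j) = of_bool (i = j)"
    and "j < k \<Longrightarrow> form (f i) (e j) = of_bool (i = j)"
  using assms form_sym[of "f i" "e j"] by (auto simp: hyperbolic_def)

text \<open>The list of all \<open>e\<close> followed by all \<open>f\<close> is dual to the same
  list with \<open>e\<close> and \<open>f\<close> exchanged.\<close>

lemma hyperbolic_dim:
  assumes "hyperbolic k e f"
  shows "2 * k \<le> V.dim E"
proof (rule dual_family_card_le)
  let ?g = "\<lambda>e f i. if i < k then e i else f (i - k)"
  show "form (?g e f i) (?g f e j) = of_bool (i = j)" if "i < 2 * k" "j < 2 * k" for i j
    using that by (auto simp: hyperbolicD[OF assms])
  show "?g e f i \<in> E" if "i < 2 * k" for i
    using that by (auto simp: hyperbolicD[OF assms])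
qed

text \<open>This is the projection onto the orthogonal complement of the hyperbolic planes. As
  \<open>e i\<close> is dual to \<open>f i\<close>, the coefficient of one is the pairing with the
  other.\<close>

definition proj :: "nat \<Rightarrow> (nat \<Rightarrow> 'v) \<Rightarrow> (nat \<Rightarrow> 'v) \<Rightarrow> 'v \<Rightarrow> 'v" where
  "proj k e f v = v - (\<Sum>i<k. form v (f i) *s e i) - (\<Sum>i<k. form v (e i) *s f i)"

context
  fixes k e f
  assumes hyp: "hyperbolic k e f"
begin

lemma proj_E: "v \<in> E \<Longrightarrow> proj k e f v \<in> E"
  unfolding proj_def using subspace_E hyperbolicD(1,2)[OF hyp]
  by (intro V.subspace_diff V.subspace_sum V.subspace_scale) auto

lemma form_proj: "form (proj k e f v) w =
    form v w - (\<Sum>i<k. form v (f i) * form (e i) w) - (\<Sum>i<k. form v (e i) * form (f i) w)"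
  by (simp add: proj_def form_simps)

lemma proj_orth:
  assumes "j < k"
  shows "form (proj k e f v) (e j) = 0" "form (proj k e f v) (f j) = 0"
proof -
  have "form (proj k e f v) (e j) = form v (e j) - (\<Sum>i<k. form v (e i) * of_bool (i = j))"
    unfolding form_proj using assms by (simp add: hyperbolicD[OF hyp])
  then show "form (proj k e f v) (e j) = 0" using assms by simp
  have "form (proj k e f v) (f j) = form v (f j) - (\<Sum>i<k. form v (f i) * of_bool (i = j))"
    unfolding form_proj using assms by (simp add: hyperbolicD[OF hyp])
  then show "form (proj k e f v) (f j) = 0" using assms by simp
qed

lemma form_proj_orth:
  assumes "\<And>i. i < k \<Longrightarrow> form w (e i) = 0" "\<And>i. i < k \<Longrightarrow> form w (f i) = 0"
  shows "form (proj k e f v) w = form v w"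
  unfolding form_proj using assms form_sym[of w] by simp

lemma proj_mod: "v - proj k e f v \<in> V.span (e ` {..<k} \<union> f ` {..<k})"
proof -
  have "v - proj k e f v = (\<Sum>i<k. form v (f i) *s e i) + (\<Sum>i<k. form v (e i) *s f i)"
    by (simp add: proj_def)
  also have "\<dots> \<in> V.span (e ` {..<k} \<union> f ` {..<k})"
    by (rule V.span_add; rule V.span_sum; rule V.span_scale; rule V.span_base; simp)
  finally show ?thesis .
qed

text \<open>Some v pairs nontrivially with u. Projecting v to the complement of the planes leaves
  this pairing unchanged, and after scaling it to 1 a multiple of u makes the partner
  isotropic.\<close>

lemma hyperbolic_extend:
  assumes "u \<in> E" "u \<noteq> 0" "form u u = 0"
    and orth: "\<And>i. i < k \<Longrightarrow> form u (e i) = 0" "\<And>i. i < k \<Longrightarrow> form u (f i) = 0"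
  shows "\<exists>w. hyperbolic (Suc k) (e(k := u)) (f(k := w))"
proof -
  obtain v where v: "v \<in> E" "form u v \<noteq> 0" using nondegenerate assms(1,2) by auto
  define v' where "v' = inverse (form u v) *s proj k e f v"
  have v'E: "v' \<in> E" unfolding v'_def using v(1) subspace_E by (simp add: V.subspace_scale proj_E)
  have v'o: "form v' (e i) = 0" "form v' (f i) = 0" if "i < k" for i
    unfolding v'_def using that by (simp_all add: form_simps proj_orth)
  have "form u (proj k e f v) = form u v"
    using form_proj_orth[of u v] orth form_sym by metis
  then have uv': "form u v' = 1" using v(2) by (simp add: v'_def form_simps)
  then have v'u: "form v' u = 1" using form_sym by metis
  \<comment> \<open>As u is isotropic and pairs to 1 with \<open>v'\<close>, subtracting t times u
    lowers the square of \<open>v'\<close> by 2t; half the square removes it.\<close>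
  define w where "w = v' - (form v' v' / 2) *s u"
  have ww: "form w w = 0" and uw: "form u w = 1"
    by (simp_all add: w_def form_simps uv' v'u assms(3))
  have wo: "form w (e i) = 0" "form w (f i) = 0" if "i < k" for i
    using that by (simp_all add: w_def form_simps v'o orth)
  have "w \<in> E" unfolding w_def
    using v'E assms(1) subspace_E by (simp add: V.subspace_scale V.subspace_diff)
  moreover have "form (e i) u = 0" "form (f i) w = 0" "form (e i) w = 0" if "i < k" for i
    using orth(1)[OF that] wo[OF that] form_sym by metis+
  ultimately have "hyperbolic (Suc k) (e(k := u)) (f(k := w))"
    unfolding hyperbolic_def using assms(1,3) orth wo ww uw hyperbolicD[OF hyp]
    by (simp add: less_Suc_eq)
  then show ?thesis ..
qed

end

lemma exists_outside:
  assumes "finite T" "card T < V.dim E"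
  shows "\<exists>z\<in>E. z \<notin> V.span T"
  using V.dim_le_card[of E T] assms by (meson leD subsetI)

section \<open>Extending an invariant isotropic flag by one vector\<close>

definition flag :: "'a set \<Rightarrow> nat \<Rightarrow> (nat \<Rightarrow> 'v) \<Rightarrow> bool" where
  "flag S k e \<longleftrightarrow> (\<forall>i<k. \<forall>x\<in>S. rep x (e i) \<in> V.span (e ` {..i}))"

context
  fixes S k e f d
  assumes hyp: "hyperbolic k e f" and flag: "flag S k e"
    and S: "subalgebra S" "derived_series S d = {0}"
begin

definition "U = V.span (e ` {..<k})"
definition "perp = {w \<in> E. \<forall>i<k. form w (e i) = 0}"

lemma perp_U: "w \<in> perp \<Longrightarrow> u \<in> U \<Longrightarrow> form w u = 0"
  unfolding U_def by (rule form_span_zero[of "e ` {..<k}"]) (auto simp: perp_def)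

lemma subspace_U: "V.subspace U"
  by (simp add: U_def)

lemma subspace_perp: "V.subspace perp"
  using subspace_E by (simp add: perp_def V.subspace_def form_simps)

lemma U_subset_perp: "U \<subseteq> perp"
proof -
  have "e ` {..<k} \<subseteq> perp" using hyperbolicD[OF hyp] by (auto simp: perp_def)
  then show ?thesis unfolding U_def using subspace_perp by (rule V.span_minimal)
qed

lemma rep_e: "x \<in> S \<Longrightarrow> i < k \<Longrightarrow> rep x (e i) \<in> U"
proof -
  assume "x \<in> S" "i < k"
  then have "rep x (e i) \<in> V.span (e ` {..i})" "e ` {..i} \<subseteq> e ` {..<k}"
    using flag by (auto simp: flag_def)
  then show ?thesis unfolding U_def using V.span_mono by auto
qed

lemma rep_U:
  assumes "x \<in> S" "u \<in> U"
  shows "rep x u \<in> U"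
  using assms(2) unfolding U_def
proof (induction rule: V.span_induct_alt)
  case base
  then show ?case by (simp add: V.span_zero)
next
  case (step c v w)
  then have "rep x v \<in> V.span (e ` {..<k})" using rep_e[OF assms(1)] by (auto simp: U_def)
  with step show ?case by (simp add: rep_add rep_scale V.span_add V.span_scale)
qed

lemma rep_perp: "x \<in> S \<Longrightarrow> w \<in> perp \<Longrightarrow> rep x w \<in> perp"
  using perp_U[of w] rep_e[of x] by (auto simp: perp_def rep_E form_rep)

text \<open>Skewness gives \<open>form (rep x w) w = 0\<close>, and w is orthogonal to
  \<open>U\<close>; pairing the eigenvalue relation with w leaves
  \<open>c * form w w = 0\<close>.\<close>

lemma rep_anisotropic:
  assumes "x \<in> S" "w \<in> perp" "form w w \<noteq> 0" "rep x w - c *s w \<in> U"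
  shows "rep x w \<in> U"
proof -
  have "form w (rep x w - c *s w) = 0" using perp_U assms(2,4) .
  then have "c * form w w = 0" using form_rep_self[of x w] form_sym[of w "rep x w"]
    by (simp add: form_simps)
  then show ?thesis using assms(3,4) by simp
qed

lemma lie_theorem_U:
  assumes "V.subspace W" "U \<subset> W" "W \<subseteq> E" "\<And>x w. x \<in> S \<Longrightarrow> w \<in> W \<Longrightarrow> rep x w \<in> W"
  shows "\<exists>w\<in>W - U. \<forall>x\<in>S. \<exists>c. rep x w - c *s w \<in> U"
proof -
  obtain B where "finite B" "E \<subseteq> V.span B" using finite_dim_E by auto
  then show ?thesis
    by (intro lie_theorem_mod[OF S subspace_U assms(1,2)]) (use assms rep_U in auto)
qed

text \<open>If the eigenvector w found in \<open>perp\<close> is anisotropic, it is annihilated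
  modulo \<open>U\<close>, and Lie's theorem is applied once more in the complement of w inside
  \<open>perp\<close>. If the second eigenvector is anisotropic too, it is also annihilated, so
  every combination of the two is an eigenvector and an isotropic one can be chosen.\<close>

lemma isotropic_eigenvector:
  assumes "2 * k + 1 < V.dim E"
  shows "\<exists>w\<in>perp - U. form w w = 0 \<and> (\<forall>x\<in>S. \<exists>c. rep x w - c *s w \<in> U)"
proof -
  have card: "card (e ` {..<k} \<union> f ` {..<k}) \<le> 2 * k"
    using card_Un_le[of "e ` {..<k}" "f ` {..<k}"] card_image_le[of "{..<k}" e]
      card_image_le[of "{..<k}" f] by simp
  have Uef: "U \<subseteq> V.span (insert w (e ` {..<k} \<union> f ` {..<k}))" for w
    unfolding U_def by (rule V.span_mono) auto
  \<comment> \<open>At most 2k + 1 vectors are spanned here, fewer than the dimension. The extra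
    vector is 0 in the search for the first eigenvector and the anisotropic w in the search for the
    second.\<close>
  have ex: "\<exists>z\<in>E. z \<notin> V.span (insert w (e ` {..<k} \<union> f ` {..<k}))" for w
    by (rule exists_outside) (use card assms card_insert_le_m1 in \<open>auto simp: card_insert_if\<close>)
  have proj_perp: "proj k e f z \<in> perp" if "z \<in> E" for z
    using proj_E[OF hyp that] proj_orth[OF hyp] by (simp add: perp_def)
  have proj_diff: "z - proj k e f z \<in> V.span (insert w (e ` {..<k} \<union> f ` {..<k}))" for z w
    using proj_mod[OF hyp, of z] V.span_mono[OF subset_insertI] by auto
  have "U \<subset> perp"
  proof -
    obtain z where z: "z \<in> E" "z \<notin> V.span (insert 0 (e ` {..<k} \<union> f ` {..<k}))" using ex by metis
    have "proj k e f z \<notin> U"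
    proof
      assume "proj k e f z \<in> U"
      then have "(z - proj k e f z) + proj k e f z \<in> V.span (insert 0 (e ` {..<k} \<union> f ` {..<k}))"
        using Uef[of 0] proj_diff[of z 0] by (intro V.span_add) auto
      with z show False by simp
    qed
    then show ?thesis using U_subset_perp proj_perp[OF z(1)] by auto
  qed
  then obtain w where w: "w \<in> perp" "w \<notin> U" "\<forall>x\<in>S. \<exists>c. rep x w - c *s w \<in> U"
    using lie_theorem_U[OF subspace_perp _ _ rep_perp] by (auto simp: perp_def)
  show ?thesis
  proof (cases "form w w = 0")
    case True
    with w show ?thesis by auto
  next
    case w0: False
    have rep_w: "rep x w \<in> U" if "x \<in> S" for x
      using rep_anisotropic[OF that w(1) w0] w(3) that by auto
    define W where "W = {v \<in> perp. form v w = 0}"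
    have W: "V.subspace W" using subspace_perp by (simp add: W_def V.subspace_def form_simps)
    have WE: "W \<subseteq> E" by (auto simp: W_def perp_def)
    \<comment> \<open>Stability under the action uses that \<open>rep x w\<close> lies in
      \<open>U\<close>, to which \<open>perp\<close> is orthogonal.\<close>
    have rep_W: "rep x v \<in> W" if "x \<in> S" "v \<in> W" for x v
      using that rep_perp perp_U[OF _ rep_w[OF that(1)]] by (simp add: W_def form_rep)
    have "U \<subset> W"
    proof -
      obtain z where z: "z \<in> E" "z \<notin> V.span (insert w (e ` {..<k} \<union> f ` {..<k}))" using ex by metis
      define a where "a = form (proj k e f z) w / form w w"
      define v where "v = proj k e f z - a *s w"
      have "v \<in> W" unfolding W_def v_def a_def using w0 proj_perp[OF z(1)] w(1) subspace_perp
        by (simp add: form_simps V.subspace_diff V.subspace_scale)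
      moreover have "v \<notin> U"
      proof
        assume "v \<in> U"
        then have "(z - proj k e f z) + (v + a *s w) \<in> V.span (insert w (e ` {..<k} \<union> f ` {..<k}))"
          using Uef[of w] proj_diff[of z w]
          by (intro V.span_add V.span_scale) (auto intro: V.span_base)
        with z show False by (simp add: v_def)
      qed
      moreover have "U \<subseteq> W" using U_subset_perp perp_U[OF w(1)] form_sym[of _ w] by (auto simp: W_def)
      ultimately show ?thesis by auto
    qed
    then obtain w' where w': "w' \<in> W" "w' \<notin> U" "\<forall>x\<in>S. \<exists>c. rep x w' - c *s w' \<in> U"
      using lie_theorem_U[OF W _ WE rep_W] by auto
    then have w'p: "w' \<in> perp" and w'w: "form w' w = 0" by (auto simp: W_def)
    show ?thesis
    proof (cases "form w' w' = 0")
      case True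
      with w' w'p show ?thesis by auto
    next
      case w'0: False
      have rep_w': "rep x w' \<in> U" if "x \<in> S" for x
        using rep_anisotropic[OF that w'p w'0] w'(3) that by auto
      \<comment> \<open>With this s the squares of w and of \<open>s *s w'\<close> cancel, as the
        two vectors are orthogonal.\<close>
      define s where "s = csqrt (- form w w / form w' w')"
      have s: "s * s = - form w w / form w' w'"
        unfolding s_def using power2_csqrt by (simp add: power2_eq_square)
      define y where "y = w + s *s w'"
      have "form y y = form w w + (s * s) * form w' w'"
        using w'w form_sym[of w w'] by (simp add: y_def form_simps)
      also have "\<dots> = 0" unfolding s using w'0 by simp
      finally have "form y y = 0" .
      moreover have "y \<in> perp" unfolding y_def
        using subspace_perp w(1) w'p by (simp add: V.subspace_add V.subspace_scale)
      moreover have "y \<notin> U"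
      proof
        assume "y \<in> U"
        then have "form w y = 0" by (rule perp_U[OF w(1)])
        then show False using w0 w'w form_sym[of w w'] by (simp add: y_def form_simps)
      qed
      moreover have "rep x y - 0 *s y \<in> U" if "x \<in> S" for x
        unfolding y_def using rep_w rep_w' that subspace_U
        by (simp add: rep_add rep_scale V.subspace_add V.subspace_scale)
      ultimately show ?thesis by (intro bexI[of _ y] conjI ballI exI[of _ 0]) auto
    qed
  qed
qed

text \<open>The isotropic eigenvector y need not be orthogonal to the \<open>f i\<close>, so it is
  projected. Since y lies in \<open>perp\<close>, the projection changes it only by an element of
  \<open>U\<close>, which preserves both isotropy and the eigenvector property modulo
  \<open>U\<close>.\<close>

lemma hyperbolic_flag_step:
  assumes "2 * k + 1 < V.dim E"
  shows "\<exists>u w. hyperbolic (Suc k) (e(k := u)) (f(k := w)) \<and> flag S (Suc k) (e(k := u))"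
proof -
  obtain y where y: "y \<in> perp" "y \<notin> U" "form y y = 0" "\<forall>x\<in>S. \<exists>c. rep x y - c *s y \<in> U"
    using isotropic_eigenvector[OF assms] by auto
  define u where "u = proj k e f y"
  have u: "u = y - (\<Sum>i<k. form y (f i) *s e i)"
    using y(1) by (simp add: u_def proj_def perp_def)
  then have yu: "y - u \<in> U"
  proof -
    have "(\<Sum>i<k. form y (f i) *s e i) \<in> U" unfolding U_def
      by (rule V.span_sum; rule V.span_scale; rule V.span_base; simp)
    then show ?thesis using u by simp
  qed
  have uE: "u \<in> E" using proj_E[OF hyp] y(1) by (simp add: u_def perp_def)
  have orth: "form u (e i) = 0" "form u (f i) = 0" if "i < k" for i
    using proj_orth[OF hyp that] by (simp_all add: u_def)
  have "form u u = form y u" unfolding u_def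
    by (rule form_proj_orth[OF hyp]) (use orth u_def in auto)
  also have "\<dots> = form y y - form y (y - u)" by (simp add: form_simps)
  also have "\<dots> = 0" using y(3) perp_U[OF y(1) yu] by simp
  finally have "form u u = 0" .
  moreover have "u \<noteq> 0" using yu y(2) by auto
  ultimately obtain w where w: "hyperbolic (Suc k) (e(k := u)) (f(k := w))"
    using hyperbolic_extend[OF hyp uE _ _ orth] by auto
  have "rep x u \<in> V.span (insert u (e ` {..<k}))" if x: "x \<in> S" for x
  proof -
    obtain c where c: "rep x y - c *s y \<in> U" using y(4) x by auto
    have "(rep x y - c *s y) + c *s (y - u) - rep x (y - u) \<in> U"
      by (rule V.subspace_diff[OF subspace_U V.subspace_add[OF subspace_U c
            V.subspace_scale[OF subspace_U yu]] rep_U[OF x yu]])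
    then have "rep x u - c *s u \<in> U"
      by (simp add: rep_diff V.scale_right_diff_distrib)
    then show ?thesis unfolding U_def V.span_insert by auto
  qed
  moreover have im_k: "(e(k := u)) ` {..k} = insert u (e ` {..<k})"
    by (auto simp: image_iff le_less)
  moreover have im: "(e(k := u)) ` {..i} = e ` {..i}" if "i < k" for i
    using that by auto
  ultimately have "rep x ((e(k := u)) i) \<in> V.span ((e(k := u)) ` {..i})"
    if "x \<in> S" "i < Suc k" for x i
    using that flag by (cases "i = k") (simp_all add: flag_def del: fun_upd_image)
  then have "flag S (Suc k) (e(k := u))" by (simp add: flag_def)
  with w show ?thesis by auto
qed

end

lemma exists_hyperbolic_flag:
  assumes "subalgebra S" "derived_series S d = {0}" "2 * k < V.dim E"
  shows "\<exists>e f. hyperbolic k e f \<and> flag S k e"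
  using assms(3)
proof (induction k)
  case 0
  then show ?case by (auto simp: hyperbolic_def flag_def)
next
  case (Suc k)
  then obtain e f where "hyperbolic k e f" "flag S k e" by auto
  from hyperbolic_flag_step[OF this assms(1,2)] show ?case using Suc.prems by auto
qed

text \<open>Invariance is recorded only for the isotropic half of the basis; skewness of the action
  later yields the triangular shape of the other half.\<close>

theorem exists_adapted_basis:
  assumes "subalgebra S" "derived_series S d = {0}" "V.dim E = 2 * n + 1"
  shows "\<exists>g. (\<forall>i\<le>2*n. g i \<in> E) \<and> (\<forall>i\<le>2*n. \<forall>j\<le>2*n. form (g i) (g j) = of_bool (i + j = 2 * n)) \<and>
    (\<forall>x\<in>S. \<forall>m<n. rep x (g m) \<in> V.span (g ` {..m}))"
proof -
  obtain e f where hyp: "hyperbolic n e f" and flag: "flag S n e"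
    using exists_hyperbolic_flag[OF assms(1,2), of n] assms(3) by auto
  have "card (e ` {..<n} \<union> f ` {..<n}) \<le> 2 * n"
    using card_Un_le[of "e ` {..<n}" "f ` {..<n}"] card_image_le[of "{..<n}" e]
      card_image_le[of "{..<n}" f] by simp
  then obtain z where z: "z \<in> E" "z \<notin> V.span (e ` {..<n} \<union> f ` {..<n})"
    using exists_outside[of "e ` {..<n} \<union> f ` {..<n}"] assms(3) by auto
  define u where "u = proj n e f z"
  have u: "u \<in> E" using proj_E[OF hyp z(1)] by (simp add: u_def)
  have "u \<noteq> 0" using proj_mod[OF hyp, of z] z(2) by (auto simp: u_def)
  have orth: "form u (e i) = 0" "form u (f i) = 0" if "i < n" for i
    using proj_orth[OF hyp that] by (simp_all add: u_def)
  \<comment> \<open>An isotropic u would extend to n + 1 hyperbolic planes, too many for dimension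
    2n + 1.\<close>
  have "form u u \<noteq> 0"
  proof
    assume "form u u = 0"
    then obtain w where "hyperbolic (Suc n) (e(n := u)) (f(n := w))"
      using hyperbolic_extend[OF hyp u \<open>u \<noteq> 0\<close> _ orth] by auto
    from hyperbolic_dim[OF this] assms(3) show False by simp
  qed
  define v where "v = inverse (csqrt (form u u)) *s u"
  have "csqrt (form u u) * csqrt (form u u) = form u u"
    using power2_csqrt[of "form u u"] by (simp add: power2_eq_square)
  then have vv: "form v v = 1" using \<open>form u u \<noteq> 0\<close>
    by (simp add: v_def form_simps field_simps)
  have vo: "form v (e i) = 0" "form v (f i) = 0" if "i < n" for i
    using orth[OF that] by (simp_all add: v_def form_simps)
  then have vo': "form (e i) v = 0" "form (f i) v = 0" if "i < n" for i
    using that form_sym by metis+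
  \<comment> \<open>Listing the \<open>f\<close> in reverse order puts dual vectors at indices with
    sum 2n, so the form becomes antidiagonal.\<close>
  define g where "g i = (if i < n then e i else if i = n then v else f (2 * n - i))" for i
  have vE: "v \<in> E" using u subspace_E by (simp add: v_def V.subspace_scale)
  have "g i \<in> E" if "i \<le> 2 * n" for i
    using that by (auto simp: g_def vE hyperbolicD(1,2)[OF hyp])
  moreover have "form (g i) (g j) = of_bool (i + j = 2 * n)" if "i \<le> 2 * n" "j \<le> 2 * n" for i j
    using that by (auto simp: g_def vv vo vo' hyperbolicD[OF hyp])
  moreover have "rep x (g m) \<in> V.span (g ` {..m})" if "x \<in> S" "m < n" for x m
  proof -
    have "g ` {..m} = e ` {..m}" using that(2) by (auto simp: g_def)
    then show ?thesis using flag that by (simp add: flag_def g_def)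
  qed
  ultimately show ?thesis by (intro exI[of _ g] conjI allI impI ballI)
qed

end

section \<open>Coordinates adapted to a solvable subalgebra\<close>

definition fscale :: "complex \<Rightarrow> (nat \<Rightarrow> complex) \<Rightarrow> nat \<Rightarrow> complex" where
  "fscale c v = (\<lambda>i. c * v i)"

definition fmat_vec :: "nat \<Rightarrow> complex mat \<Rightarrow> (nat \<Rightarrow> complex) \<Rightarrow> nat \<Rightarrow> complex" where
  "fmat_vec N A v = (\<lambda>i. if i < N then \<Sum>j<N. A $$ (i, j) * v j else 0)"

definition dot :: "nat \<Rightarrow> (nat \<Rightarrow> complex) \<Rightarrow> (nat \<Rightarrow> complex) \<Rightarrow> complex" where
  "dot N v w = (\<Sum>i<N. v i * w i)"

text \<open>This models the space of column vectors of length \<open>N\<close> as a subspace of a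
  type that does not depend on \<open>N\<close>.\<close>

definition fspace :: "nat \<Rightarrow> (nat \<Rightarrow> complex) set" where
  "fspace N = {v. \<forall>i\<ge>N. v i = 0}"

definition unit_fun :: "nat \<Rightarrow> nat \<Rightarrow> complex" where
  "unit_fun i = (\<lambda>j. of_bool (i = j))"

interpretation F: complex_vector_space fscale
  by unfold_locales (auto simp: fscale_def fun_eq_iff algebra_simps)

lemma sum_fun_apply: "(\<Sum>i\<in>A. f i) x = (\<Sum>i\<in>A. f i (x :: 'b) :: complex)"
  by (induction A rule: infinite_finite_induct) simp_all

lemma fspace_span: "fspace N \<subseteq> F.span (unit_fun ` {..<N})"
proof
  fix v assume v: "v \<in> fspace N"
  have "v = (\<Sum>i<N. fscale (v i) (unit_fun i))"
  proof
    fix j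
    have "(\<Sum>i<N. fscale (v i) (unit_fun i)) j = (\<Sum>i<N. v i * of_bool (i = j))"
      by (simp add: sum_fun_apply fscale_def unit_fun_def)
    then show "v j = (\<Sum>i<N. fscale (v i) (unit_fun i)) j"
      using v by (cases "j < N") (auto simp: fspace_def)
  qed
  also have "\<dots> \<in> F.span (unit_fun ` {..<N})"
    by (rule F.span_sum; rule F.span_scale; rule F.span_base; simp)
  finally show "v \<in> F.span (unit_fun ` {..<N})" .
qed

lemma unit_fun_fspace: "i < N \<Longrightarrow> unit_fun i \<in> fspace N"
  by (auto simp: unit_fun_def fspace_def)

lemma dot_unit_fun: "i < N \<Longrightarrow> dot N v (unit_fun i) = v i"
  by (simp add: dot_def unit_fun_def)

lemma fmat_vec_mult:
  assumes "A \<in> carrier_mat N N" "B \<in> carrier_mat N N"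
  shows "fmat_vec N (A * B) v = fmat_vec N A (fmat_vec N B v)"
proof
  fix i
  show "fmat_vec N (A * B) v i = fmat_vec N A (fmat_vec N B v) i"
  proof (cases "i < N")
    case True
    have "(\<Sum>j<N. (A * B) $$ (i, j) * v j) = (\<Sum>j<N. \<Sum>k<N. A $$ (i, k) * B $$ (k, j) * v j)"
      using True assms
      by (intro sum.cong) (auto simp: scalar_prod_def sum_distrib_right atLeast0LessThan)
    also have "\<dots> = (\<Sum>k<N. \<Sum>j<N. A $$ (i, k) * B $$ (k, j) * v j)" by (rule sum.swap)
    also have "\<dots> = (\<Sum>k<N. A $$ (i, k) * (\<Sum>j<N. B $$ (k, j) * v j))"
      by (simp add: sum_distrib_left mult.assoc)
    finally show ?thesis using True by (simp add: fmat_vec_def)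
  qed (simp add: fmat_vec_def)
qed

lemma fmat_vec_diff:
  assumes "A \<in> carrier_mat N N" "B \<in> carrier_mat N N"
  shows "fmat_vec N (A - B) v = fmat_vec N A v - fmat_vec N B v"
  using assms by (auto simp: fmat_vec_def fun_eq_iff left_diff_distrib sum_subtractf)

lemma so_entry: "A \<in> so N \<Longrightarrow> i < N \<Longrightarrow> j < N \<Longrightarrow> A $$ (j, i) = - A $$ (i, j)"
proof -
  assume A: "A \<in> so N" "i < N" "j < N"
  from A(1) have "transpose_mat A $$ (i, j) = (- A) $$ (i, j)" by (simp add: so_def)
  moreover have "A \<in> carrier_mat N N" using A by (simp add: so_def)
  ultimately show ?thesis using A(2,3) by auto
qed

lemma dot_fmat_vec_skew:
  assumes "A \<in> so N"
  shows "dot N (fmat_vec N A v) w = - dot N v (fmat_vec N A w)"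
proof -
  have "dot N (fmat_vec N A v) w = (\<Sum>i<N. \<Sum>j<N. A $$ (i, j) * v j * w i)"
    by (simp add: dot_def fmat_vec_def sum_distrib_right)
  also have "\<dots> = (\<Sum>j<N. \<Sum>i<N. A $$ (i, j) * v j * w i)" by (rule sum.swap)
  also have "\<dots> = (\<Sum>j<N. \<Sum>i<N. - (v j * (A $$ (j, i) * w i)))"
  proof (intro sum.cong refl)
    fix i j assume "j \<in> {..<N}" "i \<in> {..<N}"
    then have "A $$ (i, j) = - A $$ (j, i)" by (intro so_entry[OF assms]) auto
    then show "A $$ (i, j) * v j * w i = - (v j * (A $$ (j, i) * w i))"
      by (simp only:) simp
  qed
  also have "\<dots> = - dot N v (fmat_vec N A w)"
    by (simp add: dot_def fmat_vec_def sum_distrib_left sum_negf)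
  finally show ?thesis .
qed

text \<open>Coordinates \<open>a x i j\<close> for which the Lie algebra becomes the algebra of skew matrices with
  bracket \<open>X J Y - Y J X\<close>, where \<open>J\<close> is the antidiagonal unit matrix. Multiplication by \<open>J\<close>
  identifies it with the matrices skew with respect to the form \<open>J\<close>, such that \<open>a x i j\<close> with
  \<open>i + j \<le> 2n\<close> are the entries on and above the diagonal.\<close>

locale so_coordinates = complex_lie_algebra scale br
  for scale :: "complex \<Rightarrow> 'a::ab_group_add \<Rightarrow> 'a" and br :: "'a \<Rightarrow> 'a \<Rightarrow> 'a" +
  fixes n :: nat and a :: "'a \<Rightarrow> nat \<Rightarrow> nat \<Rightarrow> complex"
  assumes a_add: "i \<le> 2 * n \<Longrightarrow> j \<le> 2 * n \<Longrightarrow> a (x + y) i j = a x i j + a y i j"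
    and a_scale: "i \<le> 2 * n \<Longrightarrow> j \<le> 2 * n \<Longrightarrow> a (scale c x) i j = c * a x i j"
    and a_skew: "i \<le> 2 * n \<Longrightarrow> j \<le> 2 * n \<Longrightarrow> a x j i = - a x i j"
    and a_br: "i \<le> 2 * n \<Longrightarrow> j \<le> 2 * n \<Longrightarrow> a (br x y) i j =
      (\<Sum>l\<le>2*n. a x i (2 * n - l) * a y l j - a y i (2 * n - l) * a x l j)"
    and a_inj: "(\<And>i j. i \<le> 2 * n \<Longrightarrow> j \<le> 2 * n \<Longrightarrow> a x i j = 0) \<Longrightarrow> x = 0"
    and a_surj: "(\<And>i j. i \<le> 2 * n \<Longrightarrow> j \<le> 2 * n \<Longrightarrow> C j i = - C i j) \<Longrightarrow>
      \<exists>x. \<forall>i\<le>2*n. \<forall>j\<le>2*n. a x i j = C i j"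

text \<open>Congruence by \<open>P\<close> keeps matrices skew. As \<open>P\<close> times its
  transpose is the antidiagonal \<open>J\<close>, the inverse of \<open>P\<close> is the transpose
  times \<open>J\<close>; inserting it between two factors turns a product of matrices into
  \<open>X J Y\<close>.\<close>

lemma (in complex_lie_algebra) so_coordinatesI:
  assumes bij: "bij_betw \<phi> UNIV (so (2 * n + 1))"
    and add: "\<And>x y. \<phi> (x + y) = \<phi> x + \<phi> y"
    and scal: "\<And>c x. \<phi> (scale c x) = c \<cdot>\<^sub>m \<phi> x"
    and brac: "\<And>x y. \<phi> (br x y) = \<phi> x * \<phi> y - \<phi> y * \<phi> x"
    and P: "P \<in> carrier_mat (2 * n + 1) (2 * n + 1)"
    and PP: "P * transpose_mat P = mat (2 * n + 1) (2 * n + 1) (\<lambda>(i, j). of_bool (i + j = 2 * n))"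
  shows "so_coordinates scale br n (\<lambda>x i j. (P * \<phi> x * transpose_mat P) $$ (i, j))"
proof -
  define N where "N = 2 * n + 1"
  define J :: "complex mat" where "J = mat N N (\<lambda>(i, j). of_bool (i + j = 2 * n))"
  define T where "T = transpose_mat P"
  define X where "X x = P * \<phi> x * T" for x
  have cP: "P \<in> carrier_mat N N" and cT: "T \<in> carrier_mat N N" and cJ: "J \<in> carrier_mat N N"
    using P by (auto simp: N_def J_def T_def)
  have assoc: "A * B * C = A * (B * C)"
    if "A \<in> carrier_mat N N" "B \<in> carrier_mat N N" "C \<in> carrier_mat N N" for A B C :: "complex mat"
    using that by (rule assoc_mult_mat)
  have mc: "A * B \<in> carrier_mat N N"
    if "A \<in> carrier_mat N N" "B \<in> carrier_mat N N" for A B :: "complex mat"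
    using that by (rule mult_carrier_mat)
  have PT: "P * T = J" using PP by (simp add: T_def J_def N_def)
  have soN: "\<phi> x \<in> so N" for x using bij by (auto simp: N_def bij_betw_def)
  then have c\<phi>: "\<phi> x \<in> carrier_mat N N" and tr: "transpose_mat (\<phi> x) = - \<phi> x" for x
    by (auto simp: so_def)
  have cX: "X x \<in> carrier_mat N N" for x unfolding X_def using cP cT c\<phi> by auto
  have JJ: "J * J = 1\<^sub>m N"
  proof (rule eq_matI)
    fix i j assume "i < dim_row (1\<^sub>m N :: complex mat)" "j < dim_col (1\<^sub>m N :: complex mat)"
    then have ij: "i < N" "j < N" by auto
    have "(J * J) $$ (i, j) = (\<Sum>l<N. of_bool (i + l = 2 * n) * of_bool (l + j = 2 * n))"
      using ij cJ by (simp add: J_def scalar_prod_def atLeast0LessThan)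
    also have "\<dots> = (\<Sum>l<N. if l = 2 * n - i then of_bool (i = j) else 0)"
      using ij by (intro sum.cong) (auto simp: N_def)
    also have "\<dots> = 1\<^sub>m N $$ (i, j)" using ij by (auto simp: N_def)
    finally show "(J * J) $$ (i, j) = 1\<^sub>m N $$ (i, j)" .
  qed (use cJ in auto)
  \<comment> \<open>\<open>Q\<close> is the inverse of \<open>P\<close>: the product
    \<open>P * T * J\<close> is \<open>J * J\<close>, the identity.\<close>
  define Q where "Q = T * J"
  have cQ: "Q \<in> carrier_mat N N" using cT cJ by (simp add: Q_def)
  have PQ: "P * Q = 1\<^sub>m N" unfolding Q_def using assoc_mult_mat[OF cP cT cJ] PT JJ by simp
  have QP: "Q * P = 1\<^sub>m N" using mat_mult_left_right_inverse[OF cP cQ PQ] .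
  have trT: "transpose_mat T = P" by (simp add: T_def)
  have trQ: "T * transpose_mat Q = 1\<^sub>m N"
    using transpose_mult[OF cQ cP] QP by (simp add: T_def)
  have trQ': "transpose_mat Q * T = 1\<^sub>m N"
    using transpose_mult[OF cP cQ] PQ by (simp add: T_def)
  have X_add: "X (x + y) = X x + X y" for x y
    unfolding X_def add using cP cT c\<phi>
    by (simp add: mult_add_distrib_mat[OF cP c\<phi> c\<phi>] add_mult_distrib_mat[of _ N N])
  have X_scale: "X (scale c x) = c \<cdot>\<^sub>m X x" for c x
    unfolding X_def scal using cP cT c\<phi>
    by (simp add: mult_smult_distrib[OF cP c\<phi>] mult_smult_assoc_mat[of _ N N])
  have X_skew: "transpose_mat (X x) = - X x" for x
  proof -
    have "transpose_mat (X x) = transpose_mat T * transpose_mat (P * \<phi> x)"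
      unfolding X_def by (rule transpose_mult[OF mult_carrier_mat[OF cP c\<phi>] cT])
    also have "\<dots> = P * (transpose_mat (\<phi> x) * T)"
      unfolding trT using transpose_mult[OF cP c\<phi>] by (simp add: T_def)
    also have "\<dots> = P * (- (\<phi> x * T))" unfolding tr
      using carrier_matD[OF c\<phi>[of x]] carrier_matD[OF cT] by simp
    also have "\<dots> = - (P * (\<phi> x * T))"
      using carrier_matD[OF c\<phi>[of x]] carrier_matD[OF cP] by simp
    also have "\<dots> = - X x" unfolding X_def using assoc_mult_mat[OF cP c\<phi> cT] by simp
    finally show ?thesis .
  qed
  have X_mult: "P * (\<phi> x * \<phi> y) * T = X x * J * X y" for x y
  proof -
    have "X x * J * X y = P * \<phi> x * (T * J) * (P * \<phi> y * T)"
      unfolding X_def using cP c\<phi>[of x] c\<phi>[of y] cT cJ by (simp add: assoc mc)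
    also have "\<dots> = P * \<phi> x * (Q * P) * (\<phi> y * T)"
      unfolding Q_def[symmetric] using cP c\<phi>[of x] c\<phi>[of y] cT cQ by (simp add: assoc mc)
    also have "\<dots> = P * (\<phi> x * \<phi> y) * T"
      unfolding QP using cP c\<phi>[of x] c\<phi>[of y] cT cQ by (simp add: assoc mc)
    finally show ?thesis by simp
  qed
  have X_br: "X (br x y) = X x * J * X y - X y * J * X x" for x y
  proof -
    have "X (br x y) = P * (\<phi> x * \<phi> y) * T - P * (\<phi> y * \<phi> x) * T"
      unfolding X_def brac
      by (simp add: mult_minus_distrib_mat[OF cP mc[OF c\<phi> c\<phi>] mc[OF c\<phi> c\<phi>]]
          minus_mult_distrib_mat[OF mc[OF cP mc[OF c\<phi> c\<phi>]] mc[OF cP mc[OF c\<phi> c\<phi>]] cT])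
    then show ?thesis unfolding X_mult .
  qed
  have le: "i \<le> 2 * n \<longleftrightarrow> i < N" for i by (auto simp: N_def)
  have entry: "(X x * J * X y) $$ (i, j) = (\<Sum>l\<le>2*n. X x $$ (i, 2 * n - l) * X y $$ (l, j))"
    if "i < N" "j < N" for x y i j
  proof -
    have XJ: "(X x * J) $$ (i, l) = X x $$ (i, 2 * n - l)" if "l < N" for l
    proof -
      have "(X x * J) $$ (i, l) = (\<Sum>k<N. X x $$ (i, k) * of_bool (k + l = 2 * n))"
        using \<open>i < N\<close> that cX[of x] by (simp add: J_def scalar_prod_def atLeast0LessThan)
      also have "\<dots> = (\<Sum>k<N. if k = 2 * n - l then X x $$ (i, k) else 0)"
        using that by (intro sum.cong) (auto simp: N_def)
      finally show ?thesis using that by (simp add: N_def)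
    qed
    have "(X x * J * X y) $$ (i, j) = (\<Sum>l<N. (X x * J) $$ (i, l) * X y $$ (l, j))"
    proof -
      have "(A * B) $$ (i, j) = (\<Sum>l<N. A $$ (i, l) * B $$ (l, j))"
        if "A \<in> carrier_mat N N" "B \<in> carrier_mat N N" for A B :: "complex mat"
        using that \<open>i < N\<close> \<open>j < N\<close> by (auto simp: scalar_prod_def atLeast0LessThan)
      from this[OF mc[OF cX cJ] cX] show ?thesis .
    qed
    also have "\<dots> = (\<Sum>l\<le>2*n. X x $$ (i, 2 * n - l) * X y $$ (l, j))"
      by (rule sum.cong) (auto simp: XJ N_def)
    finally show ?thesis .
  qed
  have inj: "x = 0" if "X x = 0\<^sub>m N N" for x
  proof -
    have "\<phi> x = (Q * P) * \<phi> x * (T * transpose_mat Q)" unfolding QP trQ using c\<phi>[of x] by simp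
    also have "\<dots> = Q * X x * transpose_mat Q"
      unfolding X_def using cP cT cQ c\<phi>[of x] by (simp add: assoc mc)
    also have "\<dots> = 0\<^sub>m N N" unfolding that using cQ by simp
    finally have "\<phi> x = 0\<^sub>m N N" .
    moreover have "\<phi> 0 = 0\<^sub>m N N"
    proof -
      have "\<phi> 0 = 0 \<cdot>\<^sub>m \<phi> 0" using scal[of 0 0] by simp
      also have "\<dots> = 0\<^sub>m N N" using c\<phi>[of 0] by (intro eq_matI) auto
      finally show ?thesis .
    qed
    ultimately show ?thesis using bij by (auto simp: bij_betw_def inj_def)
  qed
  have surj: "\<exists>x. X x = C" if C: "C \<in> carrier_mat N N" "transpose_mat C = - C" for C
  proof -
    define A where "A = Q * C * transpose_mat Q"
    have cA: "A \<in> carrier_mat N N" using cQ C by (simp add: A_def)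
    have "transpose_mat A = transpose_mat (transpose_mat Q) * transpose_mat (Q * C)"
      unfolding A_def using cQ C(1) by (intro transpose_mult[of _ N N _ N]) auto
    also have "\<dots> = Q * (transpose_mat C * transpose_mat Q)"
      using transpose_mult[OF cQ C(1)] by simp
    also have "\<dots> = Q * (- (C * transpose_mat Q))" unfolding C(2)
      using carrier_matD[OF C(1)] carrier_matD[OF cQ] by simp
    also have "\<dots> = - (Q * (C * transpose_mat Q))"
      using carrier_matD[OF C(1)] carrier_matD[OF cQ] by simp
    also have "\<dots> = - A" unfolding A_def using assoc_mult_mat[OF cQ C(1), of "transpose_mat Q" N] cQ by simp
    finally have "A \<in> so N" using cA by (simp add: so_def)
    then have "A \<in> range \<phi>" using bij by (simp add: bij_betw_def N_def)
    then obtain x where x: "\<phi> x = A" by auto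
    have "X x = (P * Q) * C * (transpose_mat Q * T)"
      unfolding X_def x A_def using cP cT cQ C(1) by (simp add: assoc mc)
    also have "\<dots> = C" unfolding PQ trQ' using C(1) by simp
    finally show ?thesis ..
  qed
  have "so_coordinates scale br n (\<lambda>x i j. X x $$ (i, j))"
  proof (unfold_locales, unfold le)
    fix i j x y c assume ij: "i < N" "j < N"
    show "X (x + y) $$ (i, j) = X x $$ (i, j) + X y $$ (i, j)"
      unfolding X_add using ij cX[of y] by simp
    show "X (scale c x) $$ (i, j) = c * X x $$ (i, j)"
      unfolding X_scale using ij cX[of x] by simp
    have "transpose_mat (X x) $$ (i, j) = (- X x) $$ (i, j)" unfolding X_skew ..
    then show "X x $$ (j, i) = - X x $$ (i, j)" using ij cX[of x] by simp
    show "X (br x y) $$ (i, j) = (\<Sum>l\<le>2*n. X x $$ (i, 2 * n - l) * X y $$ (l, j) -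
        X y $$ (i, 2 * n - l) * X x $$ (l, j))"
      unfolding X_br sum_subtractf entry[OF ij, symmetric] using ij cX[of x] cX[of y] cJ by simp
  next
    fix x assume "\<And>i j. i < N \<Longrightarrow> j < N \<Longrightarrow> X x $$ (i, j) = 0"
    then have "X x = 0\<^sub>m N N" using cX[of x] by (intro eq_matI) auto
    then show "x = 0" by (rule inj)
  next
    fix c :: "nat \<Rightarrow> nat \<Rightarrow> complex"
    assume c: "\<And>i j. i < N \<Longrightarrow> j < N \<Longrightarrow> c j i = - c i j"
    have "\<exists>x. X x = mat N N (\<lambda>(i, j). c i j)"
    proof (rule surj)
      show "transpose_mat (mat N N (\<lambda>(i, j). c i j)) = - mat N N (\<lambda>(i, j). c i j)"
      proof (rule eq_matI)
        fix i j assume "i < dim_row (- mat N N (\<lambda>(i, j). c i j))" "j < dim_col (- mat N N (\<lambda>(i, j). c i j))"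
        then have "i < N" "j < N" by auto
        with c[OF this] show "transpose_mat (mat N N (\<lambda>(i, j). c i j)) $$ (i, j) =
            (- mat N N (\<lambda>(i, j). c i j)) $$ (i, j)" by (simp del: minus_minus)
      qed auto
    qed simp
    then obtain x where "X x = mat N N (\<lambda>(i, j). c i j)" ..
    then show "\<exists>x. \<forall>i<N. \<forall>j<N. X x $$ (i, j) = c i j" by (intro exI[of _ x]) auto
  qed
  then show ?thesis unfolding X_def T_def .
qed

text \<open>The entry \<open>a x i j\<close> is the pairing of \<open>g (2 * n - i)\<close> with the
  image of \<open>g (2 * n - j)\<close>. If j > n, this image lies in the span of the g with index
  at most 2n - j, whereas \<open>g (2 * n - i)\<close> pairs only with \<open>g i\<close>; so the
  entry vanishes when i + j > 2n. If j \<le> n, then i > n, and skewness exchanges the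
  indices.\<close>

theorem (in complex_lie_algebra) exists_coordinates:
  assumes "type_B n" "solvable_subalgebra b"
  shows "\<exists>a. so_coordinates scale br n a \<and>
    (\<forall>x\<in>b. \<forall>i\<le>2*n. \<forall>j\<le>2*n. 2 * n < i + j \<longrightarrow> a x i j = 0)"
proof -
  obtain \<phi> where bij: "bij_betw \<phi> UNIV (so (2 * n + 1))"
    and add: "\<And>x y. \<phi> (x + y) = \<phi> x + \<phi> y"
    and scal: "\<And>c x. \<phi> (scale c x) = c \<cdot>\<^sub>m \<phi> x"
    and brac: "\<And>x y. \<phi> (br x y) = \<phi> x * \<phi> y - \<phi> y * \<phi> x"
    using assms(1) unfolding type_B_def by auto
  define N where "N = 2 * n + 1"
  have soN: "\<phi> x \<in> so N" for x using bij by (auto simp: N_def bij_betw_def)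
  then have c\<phi>: "\<phi> x \<in> carrier_mat N N" for x by (auto simp: so_def)
  interpret O: orthogonal_representation scale br fscale "\<lambda>x. fmat_vec N (\<phi> x)" "dot N" "fspace N"
  proof (unfold_locales)
    fix x y and v w u :: "nat \<Rightarrow> complex" and c
    show "fmat_vec N (\<phi> x) (v + w) = fmat_vec N (\<phi> x) v + fmat_vec N (\<phi> x) w"
      by (auto simp: fmat_vec_def fun_eq_iff distrib_left sum.distrib)
    show "fmat_vec N (\<phi> x) (fscale c v) = fscale c (fmat_vec N (\<phi> x) v)"
      by (auto simp: fmat_vec_def fscale_def fun_eq_iff sum_distrib_left mult_ac)
    show "fmat_vec N (\<phi> (br x y)) v = fmat_vec N (\<phi> x) (fmat_vec N (\<phi> y) v) - fmat_vec N (\<phi> y) (fmat_vec N (\<phi> x) v)"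
      unfolding brac using c\<phi>[of x] c\<phi>[of y] by (simp add: fmat_vec_diff fmat_vec_mult)
    show "dot N (u + v) w = dot N u w + dot N v w" by (simp add: dot_def distrib_right sum.distrib)
    show "dot N (fscale c v) w = c * dot N v w"
      by (simp add: dot_def fscale_def sum_distrib_left mult.assoc)
    show "dot N v w = dot N w v" by (simp add: dot_def mult.commute)
    show "dot N (fmat_vec N (\<phi> x) v) w = - dot N v (fmat_vec N (\<phi> x) w)"
      by (rule dot_fmat_vec_skew[OF soN])
    show "F.subspace (fspace N)" by (auto simp: F.subspace_def fspace_def fscale_def)
    show "fmat_vec N (\<phi> x) v \<in> fspace N" by (simp add: fspace_def fmat_vec_def)
    show "\<exists>w\<in>fspace N. dot N v w \<noteq> 0" if "v \<in> fspace N" "v \<noteq> 0"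
    proof -
      obtain i where "v i \<noteq> 0" using \<open>v \<noteq> 0\<close> by (auto simp: fun_eq_iff)
      moreover from this have "i < N" using \<open>v \<in> fspace N\<close> by (auto simp: fspace_def not_le[symmetric])
      ultimately show ?thesis using unit_fun_fspace dot_unit_fun by metis
    qed
    show "\<exists>B. finite B \<and> fspace N \<subseteq> F.span B" using fspace_span by blast
  qed
  have ind: "F.independent (unit_fun ` {..<N}) \<and> card (unit_fun ` {..<N}) = N"
    by (rule O.dual_family_independent[of _ _ unit_fun])
      (simp only: dot_unit_fun, simp add: unit_fun_def)
  have "unit_fun ` {..<N} \<subseteq> fspace N" using unit_fun_fspace by auto
  then have dimE: "F.dim (fspace N) = 2 * n + 1"
    using F.basis_card_eq_dim[of "unit_fun ` {..<N}" "fspace N"] ind fspace_span[of N]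
    by (simp add: N_def)
  obtain d where d: "derived_series b d = {0}" "subalgebra b"
    using assms(2) by (auto simp: solvable_subalgebra_def)
  from O.exists_adapted_basis[OF d(2,1) dimE] obtain g
    where "\<forall>i\<le>2*n. g i \<in> fspace N"
      and "\<forall>i\<le>2*n. \<forall>j\<le>2*n. dot N (g i) (g j) = of_bool (i + j = 2 * n)"
      and "\<forall>x\<in>b. \<forall>m<n. fmat_vec N (\<phi> x) (g m) \<in> F.span (g ` {..m})"
    by (elim exE conjE)
  then have gg: "\<And>i j. i \<le> 2 * n \<Longrightarrow> j \<le> 2 * n \<Longrightarrow> dot N (g i) (g j) = of_bool (i + j = 2 * n)"
    and gb: "\<And>x m. x \<in> b \<Longrightarrow> m < n \<Longrightarrow> fmat_vec N (\<phi> x) (g m) \<in> F.span (g ` {..m})"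
    by simp_all
  \<comment> \<open>The rows run through the basis backwards, so that the invariant flag yields
    zeros at i + j > 2n rather than at i + j < 2n.\<close>
  define P where "P = mat N N (\<lambda>(i, p). g (2 * n - i) p)"
  have P: "P \<in> carrier_mat N N" by (simp add: P_def)
  have PP: "P * transpose_mat P = mat N N (\<lambda>(i, j). of_bool (i + j = 2 * n))"
  proof (rule eq_matI)
    fix i j assume "i < dim_row (mat N N (\<lambda>(i, j). of_bool (i + j = 2 * n) :: complex))"
      "j < dim_col (mat N N (\<lambda>(i, j). of_bool (i + j = 2 * n) :: complex))"
    then have ij: "i \<le> 2 * n" "j \<le> 2 * n" by (auto simp: N_def)
    have "(P * transpose_mat P) $$ (i, j) = dot N (g (2 * n - i)) (g (2 * n - j))"
      using ij by (simp add: P_def N_def dot_def scalar_prod_def atLeast0LessThan)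
    also have "\<dots> = of_bool (i + j = 2 * n)" using gg[of "2 * n - i" "2 * n - j"] ij by auto
    finally show "(P * transpose_mat P) $$ (i, j) = mat N N (\<lambda>(i, j). of_bool (i + j = 2 * n)) $$ (i, j)"
      using ij by (simp add: N_def)
  qed (auto simp: P_def)
  define a where "a = (\<lambda>x i j. (P * \<phi> x * transpose_mat P) $$ (i, j))"
  have a: "so_coordinates scale br n a"
    unfolding a_def using so_coordinatesI[OF bij add scal brac] P PP by (simp add: N_def)
  then interpret A: so_coordinates scale br n a .
  have a_form: "a x i j = dot N (g (2 * n - i)) (fmat_vec N (\<phi> x) (g (2 * n - j)))"
    if "i \<le> 2 * n" "j \<le> 2 * n" for x i j
  proof -
    have "i < N" "j < N" using that by (auto simp: N_def)
    then have "a x i j = (\<Sum>q<N. \<Sum>p<N. g (2 * n - i) p * \<phi> x $$ (p, q) * g (2 * n - j) q)"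
      using c\<phi>[of x] by (simp add: a_def P_def scalar_prod_def atLeast0LessThan sum_distrib_right)
    also have "\<dots> = (\<Sum>p<N. \<Sum>q<N. g (2 * n - i) p * \<phi> x $$ (p, q) * g (2 * n - j) q)"
      by (rule sum.swap)
    finally show ?thesis by (simp add: dot_def fmat_vec_def sum_distrib_left mult.assoc)
  qed
  have upper: "a x i j = 0" if "x \<in> b" "i \<le> 2 * n" "j \<le> 2 * n" "2 * n < i + j" "n < j" for x i j
    unfolding a_form[OF that(2,3)]
  proof (rule O.form_span_zero)
    show "fmat_vec N (\<phi> x) (g (2 * n - j)) \<in> F.span (g ` {..2 * n - j})"
      using that by (intro gb) auto
    show "dot N (g (2 * n - i)) u = 0" if "u \<in> g ` {..2 * n - j}" for u
      using that \<open>i \<le> 2 * n\<close> \<open>j \<le> 2 * n\<close> \<open>2 * n < i + j\<close> by (auto simp: gg)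
  qed
  have "a x i j = 0" if "x \<in> b" "i \<le> 2 * n" "j \<le> 2 * n" "2 * n < i + j" for x i j
  proof (cases "n < j")
    case False
    then have "a x j i = 0" using that by (intro upper) auto
    then show ?thesis using A.a_skew[of j i x] that by simp
  qed (use upper that in auto)
  with a show ?thesis by auto
qed

section \<open>Ad-nilpotent ideals and root ideals\<close>

text \<open>With standard coordinates eps_0, ..., eps_(n-1), the pair (i, j) stands for the positive
  root eps_i + eps_j if j < n, eps_i if j = n, and eps_i - eps_(2n-j) if j > n. Lowering an index by
  1 adds a simple root, so these sets are the upper sets of the root poset.\<close>

definition root_ideals :: "nat \<Rightarrow> (nat \<times> nat) set set" where
  "root_ideals n = {\<Phi>. (\<forall>i j. (i, j) \<in> \<Phi> \<longrightarrow> i < j \<and> i + j < 2 * n) \<and>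
     (\<forall>i j i' j'. (i, j) \<in> \<Phi> \<longrightarrow> i' \<le> i \<longrightarrow> j' \<le> j \<longrightarrow> i' < j' \<longrightarrow> (i', j') \<in> \<Phi>)}"

context so_coordinates
begin

section \<open>The filtration by superdiagonals\<close>

lemma a_0: "i \<le> 2 * n \<Longrightarrow> j \<le> 2 * n \<Longrightarrow> a 0 i j = 0"
  using a_scale[of i j 0 0] by simp

lemma a_diff: "i \<le> 2 * n \<Longrightarrow> j \<le> 2 * n \<Longrightarrow> a (x - y) i j = a x i j - a y i j"
  using a_add[of i j "x - y" y] by simp

lemma a_diag: "i \<le> 2 * n \<Longrightarrow> a x i i = 0"
  using a_skew[of i i x] by simp

lemma a_inj_upper:
  assumes "\<And>i j. i < j \<Longrightarrow> j \<le> 2 * n \<Longrightarrow> a x i j = 0"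
  shows "x = 0"
proof (rule a_inj)
  fix i j assume "i \<le> 2 * n" "j \<le> 2 * n"
  then show "a x i j = 0"
    using assms[of i j] assms[of j i] a_skew[of j i x] a_diag[of i x]
    by (cases i j rule: linorder_cases) simp_all
qed

text \<open>After multiplication by \<open>J\<close>, these are the matrices whose entries vanish
  below the k-th superdiagonal: \<open>filt 0\<close> is the upper triangular subalgebra and
  \<open>filt 1\<close> its strictly upper triangular part.\<close>

definition filt :: "nat \<Rightarrow> 'a set" where
  "filt k = {x. \<forall>i\<le>2*n. \<forall>j\<le>2*n. 2 * n < i + j + k \<longrightarrow> a x i j = 0}"

lemma filtD: "x \<in> filt k \<Longrightarrow> i \<le> 2 * n \<Longrightarrow> j \<le> 2 * n \<Longrightarrow> 2 * n < i + j + k \<Longrightarrow> a x i j = 0"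
  by (simp add: filt_def)

lemma subspace_filt: "subspace (filt k)"
  by (simp add: subspace_def filt_def a_0 a_add a_scale)

lemma filt_mono: "k \<le> l \<Longrightarrow> filt l \<subseteq> filt k"
  by (auto simp: filt_def)

lemma filt_eq_0: "2 * n < k \<Longrightarrow> filt k = {0}"
  using a_inj by (auto simp: filt_def a_0)

text \<open>In each summand the middle index l is too small for one factor or too large for the
  other.\<close>

lemma br_filt:
  assumes "x \<in> filt p" "y \<in> filt q"
  shows "br x y \<in> filt (p + q)"
proof -
  have "a (br x y) i j = 0" if ij: "i \<le> 2 * n" "j \<le> 2 * n" "2 * n < i + j + (p + q)" for i j
    unfolding a_br[OF ij(1,2)]
  proof (rule sum.neutral, rule ballI)
    fix l assume l: "l \<in> {..2 * n}"
    have "a x i (2 * n - l) * a y l j = 0"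
      using filtD[OF assms(1), of i "2 * n - l"] filtD[OF assms(2), of l j] ij l
      by (cases "l < i + p") auto
    moreover have "a y i (2 * n - l) * a x l j = 0"
      using filtD[OF assms(2), of i "2 * n - l"] filtD[OF assms(1), of l j] ij l
      by (cases "l < i + q") auto
    ultimately show "a x i (2 * n - l) * a y l j - a y i (2 * n - l) * a x l j = 0"
      by (simp only: diff_self)
  qed
  then show ?thesis by (simp add: filt_def)
qed

text \<open>On the diagonal only the summand l = i survives, and it cancels in the commutator
  because diagonal parts commute.\<close>

lemma br_filt_0:
  assumes "x \<in> filt 0" "y \<in> filt 0"
  shows "br x y \<in> filt 1"
proof -
  have "a (br x y) i j = 0" if ij: "i \<le> 2 * n" "j \<le> 2 * n" "2 * n < i + j + 1" for i j
    unfolding a_br[OF ij(1,2)]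
  proof (rule sum.neutral, rule ballI)
    fix l assume l: "l \<in> {..2 * n}"
    show "a x i (2 * n - l) * a y l j - a y i (2 * n - l) * a x l j = 0"
    proof (cases "l = i \<and> j = 2 * n - i")
      case False
      then have "l < i \<or> 2 * n < l + j" using ij by auto
      then show ?thesis
        using filtD[OF assms(1), of i "2 * n - l"] filtD[OF assms(2), of l j]
          filtD[OF assms(2), of i "2 * n - l"] filtD[OF assms(1), of l j] ij l by auto
    qed simp
  qed
  then show ?thesis by (simp add: filt_def)
qed

lemma derived_series_filt: "derived_series (filt 0) k \<subseteq> filt k"
proof (induction k)
  case (Suc k)
  have "br x y \<in> filt (Suc k)" if "x \<in> filt k" "y \<in> filt k" for x y
  \<comment> \<open>For k = 0 additivity of the filtration gains nothing and the commuting diagonals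
    are needed; for k > 0 the level k + k is at least k + 1.\<close>
  proof (cases k)
    case 0
    then show ?thesis using br_filt_0 that by simp
  next
    case (Suc m)
    then show ?thesis using br_filt[OF that] filt_mono[of "Suc k" "k + k"] by auto
  qed
  with Suc have "{br x y | x y. x \<in> derived_series (filt 0) k \<and> y \<in> derived_series (filt 0) k} \<subseteq> filt (Suc k)"
    by auto
  then show ?case using subspace_filt by (simp add: span_minimal)
qed simp

lemma solvable_filt_0: "solvable_subalgebra (filt 0)"
  unfolding solvable_subalgebra_def
proof
  show "subalgebra (filt 0)"
    using br_filt[of _ 0 _ 0] by (simp add: subalgebra_def subspace_filt)
  have "derived_series (filt 0) (Suc (2 * n)) = {0}"
    using derived_series_filt[of "Suc (2 * n)"] filt_eq_0[of "Suc (2 * n)"] span_zero by auto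
  then show "\<exists>k. derived_series (filt 0) k = {0}" ..
qed

lemma ad_filt_1:
  assumes "x \<in> filt 1" "y \<in> filt 0"
  shows "(br x ^^ k) y \<in> filt k"
proof (induction k)
  case (Suc k)
  then show ?case using br_filt[OF assms(1)] by simp
qed (simp add: assms)

text \<open>These are the skew matrix units: root vectors when p < q and p + q < 2n, and Cartan
  elements when p + q = 2n.\<close>

definition el :: "nat \<Rightarrow> nat \<Rightarrow> 'a" where
  "el p q = (SOME x. \<forall>i\<le>2*n. \<forall>j\<le>2*n. a x i j =
     of_bool (i = p \<and> j = q) - of_bool (i = q \<and> j = p))"

lemma a_el:
  assumes "i \<le> 2 * n" "j \<le> 2 * n"
  shows "a (el p q) i j = of_bool (i = p \<and> j = q) - of_bool (i = q \<and> j = p)"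
proof -
  have "\<exists>x. \<forall>i\<le>2*n. \<forall>j\<le>2*n. a x i j = of_bool (i = p \<and> j = q) - of_bool (i = q \<and> j = p)"
    by (rule a_surj) (simp add: conj_commute)
  from someI_ex[OF this, folded el_def] show ?thesis using assms by simp
qed

lemma el_filt: "p + q + k \<le> 2 * n \<Longrightarrow> el p q \<in> filt k"
  by (auto simp: filt_def a_el)

lemma a_br_el:
  assumes "i \<le> 2 * n" "j \<le> 2 * n" "p \<le> 2 * n" "q \<le> 2 * n"
  shows "a (br (el p q) y) i j = of_bool (i = p) * a y (2 * n - q) j - of_bool (i = q) * a y (2 * n - p) j
    - of_bool (j = q) * a y i (2 * n - p) + of_bool (j = p) * a y i (2 * n - q)"
proof -
  \<comment> \<open>Truncated subtraction makes reflection of indices reversible only in the range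
    up to 2n.\<close>
  have e: "2 * n - l = r \<longleftrightarrow> l = 2 * n - r" if "l \<le> 2 * n" "r \<le> 2 * n" for l r
    using that by auto
  have "(\<Sum>l\<le>2*n. a (el p q) i (2 * n - l) * a y l j) =
      (\<Sum>l\<le>2*n. (if l = 2 * n - q then of_bool (i = p) * a y l j else 0) -
        (if l = 2 * n - p then of_bool (i = q) * a y l j else 0))"
    using assms e[of _ p] e[of _ q]
    by (intro sum.cong refl, cases "i = p"; cases "i = q"; cases "p = q") (simp_all add: a_el)
  also have "\<dots> = of_bool (i = p) * a y (2 * n - q) j - of_bool (i = q) * a y (2 * n - p) j"
    by (simp add: sum_subtractf)
  finally have 1: "(\<Sum>l\<le>2*n. a (el p q) i (2 * n - l) * a y l j) =
      of_bool (i = p) * a y (2 * n - q) j - of_bool (i = q) * a y (2 * n - p) j" .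
  have "(\<Sum>l\<le>2*n. a y i (2 * n - l) * a (el p q) l j) =
      (\<Sum>l\<le>2*n. (if l = p then of_bool (j = q) * a y i (2 * n - l) else 0) -
        (if l = q then of_bool (j = p) * a y i (2 * n - l) else 0))"
    using assms
    by (intro sum.cong refl, cases "j = p"; cases "j = q"; cases "p = q") (simp_all add: a_el)
  also have "\<dots> = of_bool (j = q) * a y i (2 * n - p) - of_bool (j = p) * a y i (2 * n - q)"
    using assms by (simp add: sum_subtractf)
  finally show ?thesis unfolding a_br[OF assms(1,2)] sum_subtractf 1 by simp
qed

text \<open>For m < n this is the m-th coordinate of the weight of the basis index i: eps_i for i <
  n, zero for i = n, and -eps_(2n-i) for i > n.\<close>

definition wt :: "nat \<Rightarrow> nat \<Rightarrow> int" where
  "wt m i = of_bool (i = m) - of_bool (i = 2 * n - m)"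

lemma a_br_cartan:
  assumes "i \<le> 2 * n" "j \<le> 2 * n" "m \<le> 2 * n"
  shows "a (br (el m (2 * n - m)) y) i j = of_int (wt m i + wt m j) * a y i j"
  using assms by (auto simp: a_br_el wt_def)

text \<open>The smaller index is below n and contributes +1 at its own coordinate. If the smaller
  indices differed, each would have to be the larger index of the other pair, contradicting the
  order. Once they agree, the remaining weight reveals the other index: +1 below n, -1 above n, and
  zero at n.\<close>

lemma wt_separates:
  assumes "i < j" "i + j < 2 * n" "k < l" "k + l < 2 * n" "(i, j) \<noteq> (k, l)"
  shows "\<exists>m<n. wt m i + wt m j \<noteq> wt m k + wt m l"
proof (rule ccontr)
  assume "\<not> ?thesis"
  then have eq: "wt m i + wt m j = wt m k + wt m l" if "m < n" for m using that by auto
  have wt_simp: "wt m i + wt m j = of_bool (i = m) + of_bool (j = m) - of_bool (j = 2 * n - m)"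
    if "m < n" "i < j" "i + j < 2 * n" for m i j
    using that by (auto simp: wt_def)
  have eq': "of_bool (i = m) + of_bool (j = m) - of_bool (j = 2 * n - m) =
      (of_bool (k = m) + of_bool (l = m) - of_bool (l = 2 * n - m) :: int)" if "m < n" for m
    using eq[OF that] wt_simp[OF that assms(1,2)] wt_simp[OF that assms(3,4)] by simp
  have "i = k"
  proof (rule ccontr)
    assume "i \<noteq> k"
    moreover have "i < n" "j \<noteq> 2 * n - i" "k < n" "l \<noteq> 2 * n - k" using assms by auto
    ultimately have "l = i" "j = k" using eq'[of i] eq'[of k] assms(1,3)
      by (auto simp: of_bool_def split: if_splits)
    with assms show False by simp
  qed
  then have eq'': "of_bool (j = m) - of_bool (j = 2 * n - m) =
      (of_bool (l = m) - of_bool (l = 2 * n - m) :: int)" if "m < n" for m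
    using eq'[OF that] by simp
  have "j = l"
  proof (cases j n rule: linorder_cases)
    case less
    then show ?thesis using eq''[of j] by (auto simp: of_bool_def split: if_splits)
  next
    case equal
    have "2 * n - l < n" if "n < l" using that assms by linarith
    with equal show ?thesis using eq''[of l] eq''[of "2 * n - l"] assms
      by (cases l n rule: linorder_cases) (auto simp: of_bool_def split: if_splits)
  next
    case greater
    then have "2 * n - j < n" using assms by linarith
    then show ?thesis using eq''[of "2 * n - j"] greater assms by (auto simp: of_bool_def split: if_splits)
  qed
  with \<open>i = k\<close> show False using assms(5) by simp
qed

text \<open>The vector \<open>el i n\<close> belongs to the short root eps_i, on which only the i-th
  diagonal entry of x acts since the middle one is zero. The powers of ad x multiply its leading
  coefficient by powers of this entry, so nilpotency makes the entry vanish.\<close>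

lemma ad_nilpotent_filt_1:
  assumes "x \<in> filt 0" "\<And>y. y \<in> filt 0 \<Longrightarrow> (br x ^^ k) y = 0"
  shows "x \<in> filt 1"
proof -
  have lower: "a x i (2 * n - i) = 0" if i: "i < n" for i
  proof -
    define z where "z k = (br x ^^ k) (el i n)" for k
    \<comment> \<open>The vanishing clause says that \<open>(i, n)\<close> stays a maximal position
      of the iterate; no other entry can then feed into it.\<close>
    have z: "z k \<in> filt 0 \<and> a (z k) i n = a x i (2 * n - i) ^ k \<and>
      (\<forall>p r. i \<le> p \<longrightarrow> n \<le> r \<longrightarrow> p \<le> 2 * n \<longrightarrow> r \<le> 2 * n \<longrightarrow> (p, r) \<noteq> (i, n) \<longrightarrow> a (z k) p r = 0)" for k
    proof (induction k)
      case 0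
      then show ?case using i by (auto simp: z_def a_el el_filt)
    next
      case (Suc k)
      have zS: "z (Suc k) = br x (z k)" by (simp add: z_def)
      have zk: "a (z k) p r = 0" if "i \<le> p" "n \<le> r" "p \<le> 2 * n" "r \<le> 2 * n" "(p, r) \<noteq> (i, n)" for p r
        using Suc that by blast
      \<comment> \<open>Triangularity and the vanishing clause leave only p = i and l = r = n, where
        the factor \<open>a x n n\<close> is zero by skewness.\<close>
      have second: "a (z k) p (2 * n - l) * a x l r = 0"
        if "i \<le> p" "n \<le> r" "p \<le> 2 * n" "r \<le> 2 * n" "l \<le> 2 * n" for p r l
      proof (cases "2 * n < l + r")
        case True
        then show ?thesis using filtD[OF assms(1), of l r] that by simp
      next
        case False
        show ?thesis
        proof (cases "p = i \<and> l = n")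
          case True
          then have "r = n" using False that by simp
          then show ?thesis using True a_diag[of n x] by simp
        next
          case False
          moreover have "n \<le> 2 * n - l" "l \<noteq> n \<Longrightarrow> 2 * n - l \<noteq> n"
            using \<open>\<not> 2 * n < l + r\<close> that by auto
          ultimately show ?thesis using zk[of p "2 * n - l"] that by auto
        qed
      qed
      have first: "a x p (2 * n - l) * a (z k) l r = (if l = i \<and> p = i \<and> r = n then a x i (2 * n - i) * a (z k) i n else 0)"
        if "i \<le> p" "n \<le> r" "p \<le> 2 * n" "r \<le> 2 * n" "l \<le> 2 * n" for p r l
      proof (cases "l < p")
        case True
        then show ?thesis using filtD[OF assms(1), of p "2 * n - l"] that by auto
      next
        case False
        then show ?thesis using zk[of l r] that by auto
      qed
      have val: "a (z (Suc k)) p r = (if p = i \<and> r = n then a x i (2 * n - i) * a (z k) i n else 0)"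
        if "i \<le> p" "n \<le> r" "p \<le> 2 * n" "r \<le> 2 * n" for p r
      proof -
        have "a (z (Suc k)) p r = (\<Sum>l\<le>2*n. if l = i \<and> p = i \<and> r = n then a x i (2 * n - i) * a (z k) i n else 0)"
          unfolding zS a_br[OF that(3,4)] by (intro sum.cong refl) (use first second that in auto)
        also have "\<dots> = (\<Sum>l\<le>2*n. if l = i then (if p = i \<and> r = n then a x i (2 * n - i) * a (z k) i n else 0) else 0)"
          by (intro sum.cong) auto
        also have "\<dots> = (if p = i \<and> r = n then a x i (2 * n - i) * a (z k) i n else 0)"
          using i by simp
        finally show ?thesis .
      qed
      have "z (Suc k) \<in> filt 0" unfolding zS using br_filt[OF assms(1), of "z k" 0] Suc by simp
      moreover have "a (z (Suc k)) i n = a x i (2 * n - i) ^ Suc k"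
        using val[of i n] i Suc by simp
      ultimately show ?case using val by auto
    qed
    have "z k = 0" unfolding z_def using i by (intro assms(2) el_filt) simp
    then show ?thesis using z[of k] a_0[of i n] i by simp
  qed
  have "a x i j = 0" if "i \<le> 2 * n" "j \<le> 2 * n" "2 * n < i + j + 1" for i j
  proof (cases "i + j = 2 * n")
    case True
    then have j: "j = 2 * n - i" "i = 2 * n - j" using that by auto
    consider "i < n" | "i = n" "j = n" | "j < n" using True by linarith
    then show ?thesis
    proof cases
      case 1
      then show ?thesis using lower[of i] j(1) by simp
    next
      case 2
      then show ?thesis using a_diag[of n x] by simp
    next
      case 3
      then show ?thesis using lower[of j] j(2) a_skew[of j i x] that by simp
    qed
  next
    case False
    then show ?thesis using filtD[OF assms(1)] that by simp
  qed
  then show ?thesis by (simp add: filt_def)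
qed

text \<open>Conversely, bracketing with an element of \<open>filt 1\<close> raises the filtration,
  which is zero from level 2n + 1 on.\<close>

lemma ad_nilpotent_ideal_iff:
  "ad_nilpotent_ideal I (filt 0) \<longleftrightarrow> lie_ideal I (filt 0) \<and> I \<subseteq> filt 1"
proof
  assume "ad_nilpotent_ideal I (filt 0)"
  then have I: "lie_ideal I (filt 0)" and nil: "\<forall>x\<in>I. \<exists>k. \<forall>y\<in>filt 0. (br x ^^ k) y = 0"
    by (auto simp: ad_nilpotent_ideal_def)
  have "x \<in> filt 1" if "x \<in> I" for x
  proof -
    obtain k where "\<forall>y\<in>filt 0. (br x ^^ k) y = 0" using nil \<open>x \<in> I\<close> by auto
    then show ?thesis using I \<open>x \<in> I\<close> by (intro ad_nilpotent_filt_1[of x k]) (auto simp: lie_ideal_def)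
  qed
  with I show "lie_ideal I (filt 0) \<and> I \<subseteq> filt 1" by auto
next
  assume I: "lie_ideal I (filt 0) \<and> I \<subseteq> filt 1"
  have "\<forall>y\<in>filt 0. (br x ^^ Suc (2 * n)) y = 0" if "x \<in> I" for x
    using ad_filt_1[of x _ "Suc (2 * n)"] filt_eq_0[of "Suc (2 * n)"] I that by blast
  then show "ad_nilpotent_ideal I (filt 0)"
    using I unfolding ad_nilpotent_ideal_def by blast
qed

section \<open>Ideals without Cartan part and their root vectors\<close>

definition supp :: "'a \<Rightarrow> (nat \<times> nat) set" where
  "supp x = {(i, j). i < j \<and> j \<le> 2 * n \<and> a x i j \<noteq> 0}"

lemma finite_supp: "finite (supp x)"
  by (rule finite_subset[of _ "{..2 * n} \<times> {..2 * n}"]) (auto simp: supp_def)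

lemma supp_empty: "supp x = {} \<longleftrightarrow> x = 0"
  using a_inj_upper[of x] a_0 by (auto simp: supp_def)

lemma supp_filt_1: "x \<in> filt 1 \<Longrightarrow> (i, j) \<in> supp x \<Longrightarrow> i < j \<and> i + j < 2 * n"
  using filtD[of x 1 i j] by (cases "i + j < 2 * n") (auto simp: supp_def)

text \<open>Of all elements of the ideal with \<open>(i, j)\<close> in their support, take one of minimal support:
  any further root in the support could be cancelled by \<open>ad h - c\<close> for a suitable Cartan element.\<close>

lemma el_in_ideal:
  assumes I: "lie_ideal I (filt 0)" "I \<subseteq> filt 1" and "x \<in> I" "(i, j) \<in> supp x"
  shows "el i j \<in> I"
  using assms(3,4)
proof (induction "card (supp x)" arbitrary: x rule: less_induct)
  case less
  have sub: "subspace I" and br_I: "\<And>h y. h \<in> filt 0 \<Longrightarrow> y \<in> I \<Longrightarrow> br h y \<in> I"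
    using I(1) by (auto simp: lie_ideal_def)
  have ij: "i < j" "i + j < 2 * n" using supp_filt_1[of x] less.prems I(2) by auto
  have aij: "a x i j \<noteq> 0" using less.prems(2) by (simp add: supp_def)
  show ?case
  proof (cases "supp x = {(i, j)}")
    case True
    have "x - scale (a x i j) (el i j) = 0"
    proof (rule a_inj_upper)
      fix k l assume kl: "k < l" "l \<le> 2 * n"
      have "(k, l) \<noteq> (i, j) \<Longrightarrow> a x k l = 0" using True kl by (auto simp: supp_def)
      then show "a (x - scale (a x i j) (el i j)) k l = 0"
        using kl ij by (auto simp: a_diff a_scale a_el)
    qed
    then have "x = scale (a x i j) (el i j)" by simp
    then have "scale (inverse (a x i j)) x = scale (inverse (a x i j)) (scale (a x i j) (el i j))"
      by (rule arg_cong)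
    then have "scale (inverse (a x i j)) x = el i j" using aij by simp
    then show ?thesis using subspace_scale[OF sub less.prems(1)] by metis
  next
    case False
    then obtain k l where kl: "(k, l) \<in> supp x" "(k, l) \<noteq> (i, j)" using less.prems(2) by auto
    then have kl': "k < l" "k + l < 2 * n" using supp_filt_1[of x] less.prems I(2) by auto
    obtain m where m: "m < n" "wt m i + wt m j \<noteq> wt m k + wt m l"
      using wt_separates[OF ij kl'] kl(2) by auto
    define y where "y = br (el m (2 * n - m)) x - scale (of_int (wt m k + wt m l)) x"
    have ay: "a y p q = of_int (wt m p + wt m q - (wt m k + wt m l)) * a x p q" if "p \<le> 2 * n" "q \<le> 2 * n" for p q
    proof -
      have "m \<le> 2 * n" using m(1) by simp
      then show ?thesis unfolding y_def of_int_diff left_diff_distrib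
        using that by (simp only: a_diff a_scale a_br_cartan)
    qed
    have "supp y \<subseteq> supp x - {(k, l)}" using kl' by (auto simp: supp_def ay)
    then have "card (supp y) < card (supp x)"
      using kl(1) finite_supp by (metis card_Diff1_less card_mono finite_Diff le_less_trans)
    moreover have "y \<in> I" unfolding y_def
      using m(1) less.prems(1) by (intro subspace_diff[OF sub] subspace_scale[OF sub] br_I el_filt) auto
    moreover have "(i, j) \<in> supp y"
    proof -
      have "of_int (wt m i + wt m j - (wt m k + wt m l)) \<noteq> (0 :: complex)"
        using m(2) by (simp only: of_int_eq_0_iff)
      then show ?thesis using ij aij by (simp add: supp_def ay del: of_int_diff of_int_add)
    qed
    ultimately show ?thesis using less.hyps by blast
  qed
qed

definition root_space :: "(nat \<times> nat) set \<Rightarrow> 'a set" where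
  "root_space \<Phi> = {x. supp x \<subseteq> \<Phi>}"

text \<open>Root vectors are subtracted one at a time, each removing one pair from the support,
  until zero remains.\<close>

lemma root_space_subset:
  assumes "subspace I" "\<And>i j. (i, j) \<in> \<Phi> \<Longrightarrow> el i j \<in> I" "x \<in> root_space \<Phi>"
  shows "x \<in> I"
  using assms(3)
proof (induction "card (supp x)" arbitrary: x rule: less_induct)
  case less
  show ?case
  proof (cases "supp x = {}")
    case True
    then show ?thesis using subspace_0[OF assms(1)] by (simp add: supp_empty)
  next
    case False
    then obtain i j where ij: "(i, j) \<in> supp x" by auto
    then have ij': "i < j" "j \<le> 2 * n" by (auto simp: supp_def)
    define y where "y = x - scale (a x i j) (el i j)"
    have ay: "a y k l = (if (k, l) = (i, j) then 0 else a x k l)" if "k < l" "l \<le> 2 * n" for k l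
      using that ij' by (auto simp: y_def a_diff a_scale a_el)
    then have sub: "supp y \<subseteq> supp x - {(i, j)}" by (auto simp: supp_def split: if_splits)
    then have "card (supp y) < card (supp x)"
      using ij finite_supp by (metis card_Diff1_less card_mono finite_Diff le_less_trans)
    moreover have "y \<in> root_space \<Phi>" using sub less.prems by (auto simp: root_space_def)
    ultimately have "y \<in> I" using less.hyps by blast
    moreover have "el i j \<in> I" using ij less.prems assms(2) by (auto simp: root_space_def)
    moreover have "x = y + scale (a x i j) (el i j)" by (simp add: y_def)
    ultimately show ?thesis using subspace_add[OF assms(1)] subspace_scale[OF assms(1)] by metis
  qed
qed

text \<open>In the bracket with an upper triangular x, the entry (i, j) receives contributions only
  from entries of y with row at least i or with column at least j, the other index being unchanged.
  Up to skewness these belong to pairs that dominate (i, j).\<close>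

lemma root_space_ideal:
  assumes "\<Phi> \<in> root_ideals n"
  shows "lie_ideal (root_space \<Phi>) (filt 0) \<and> root_space \<Phi> \<subseteq> filt 1"
proof
  have P: "i < j \<and> i + j < 2 * n" if "(i, j) \<in> \<Phi>" for i j
    using assms that by (auto simp: root_ideals_def)
  have down: "(i', j') \<in> \<Phi>" if "(i, j) \<in> \<Phi>" "i' \<le> i" "j' \<le> j" "i' < j'" for i j i' j'
    using assms that unfolding root_ideals_def by blast
  show sub1: "root_space \<Phi> \<subseteq> filt 1"
  proof
    fix x assume x: "x \<in> root_space \<Phi>"
    have upper: "a x i j = 0" if "i < j" "j \<le> 2 * n" "2 * n \<le> i + j" for i j
      using x P[of i j] that by (auto simp: root_space_def supp_def)
    have "a x i j = 0" if "i \<le> 2 * n" "j \<le> 2 * n" "2 * n < i + j + 1" for i j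
      using upper[of i j] upper[of j i] a_diag[of i x] a_skew[of j i x] that
      by (cases i j rule: linorder_cases) auto
    then show "x \<in> filt 1" by (simp add: filt_def)
  qed
  have "subspace (root_space \<Phi>)"
    unfolding root_space_def supp_def subspace_def
    by (auto simp: a_0 a_add a_scale subset_iff) (metis add.right_neutral)
  moreover have "br x y \<in> root_space \<Phi>" if x: "x \<in> filt 0" and y: "y \<in> root_space \<Phi>" for x y
  proof -
    have y': "(i, j) \<in> \<Phi>" if "a y i j \<noteq> 0" "i < j" "j \<le> 2 * n" for i j
      using y that by (auto simp: root_space_def supp_def)
    have "(i, j) \<in> \<Phi>" if ij: "i < j" "j \<le> 2 * n" "a (br x y) i j \<noteq> 0" for i j
    proof -
      have "\<exists>l\<le>2*n. a x i (2 * n - l) * a y l j - a y i (2 * n - l) * a x l j \<noteq> 0"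
      proof (rule ccontr)
        assume "\<not> ?thesis"
        then have "a (br x y) i j = 0" using ij by (subst a_br) (auto intro!: sum.neutral)
        with ij show False by simp
      qed
      then obtain l where l: "l \<le> 2 * n" "a x i (2 * n - l) * a y l j \<noteq> 0 \<or> a y i (2 * n - l) * a x l j \<noteq> 0"
        by (metis diff_self)
      from l(2) show ?thesis
      proof
        assume "a x i (2 * n - l) * a y l j \<noteq> 0"
        then have xl: "a x i (2 * n - l) \<noteq> 0" and yl: "a y l j \<noteq> 0" by auto
        have "i \<le> l"
        proof (rule ccontr)
          assume "\<not> i \<le> l"
          then have "i \<le> 2 * n" "2 * n < i + (2 * n - l) + 0" using l(1) ij by linarith+
          from filtD[OF x this(1) _ this(2)] xl show False by simp
        qed
        \<comment> \<open>For l > j the entry of y belongs by skewness to the pair (j, l), which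
          dominates (i, j) because i < j < l.\<close>
        consider "l < j" | "l = j" | "j < l" by linarith
        then show ?thesis
        proof cases
          case 1
          then show ?thesis using down[OF y'[OF yl]] ij \<open>i \<le> l\<close> by auto
        next
          case 2
          then show ?thesis using yl a_diag ij by simp
        next
          case 3
          have "a y j l \<noteq> 0" using yl a_skew[of l j y] l ij by simp
          from y'[OF this 3 l(1)] show ?thesis by (rule down) (use 3 ij in auto)
        qed
      next
        assume "a y i (2 * n - l) * a x l j \<noteq> 0"
        then have xl: "a x l j \<noteq> 0" and yl: "a y i (2 * n - l) \<noteq> 0" by auto
        have "l + j \<le> 2 * n" using filtD[OF x l(1) ij(2)] xl by fastforce
        then have "j \<le> 2 * n - l" by simp
        then show ?thesis using down[OF y'[OF yl]] ij by auto
      qed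
    qed
    then show ?thesis by (auto simp: root_space_def supp_def)
  qed
  ultimately show "lie_ideal (root_space \<Phi>) (filt 0)"
    using sub1 filt_mono[of 0 1] by (auto simp: lie_ideal_def)
qed

definition roots_of :: "'a set \<Rightarrow> (nat \<times> nat) set" where
  "roots_of I = {(i, j). i < j \<and> i + j < 2 * n \<and> el i j \<in> I}"

lemma supp_el: "i < j \<Longrightarrow> j \<le> 2 * n \<Longrightarrow> supp (el i j) = {(i, j)}"
  by (auto simp: supp_def a_el of_bool_def split: if_splits)

lemma roots_of_root_space:
  assumes "\<Phi> \<in> root_ideals n"
  shows "roots_of (root_space \<Phi>) = \<Phi>"
proof -
  have P: "i < j \<and> i + j < 2 * n" if "(i, j) \<in> \<Phi>" for i j
    using assms that by (simp add: root_ideals_def)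
  have "(i, j) \<in> roots_of (root_space \<Phi>) \<longleftrightarrow> (i, j) \<in> \<Phi>" for i j
    using P[of i j] by (auto simp: roots_of_def root_space_def supp_el)
  then show ?thesis by auto
qed

context
  fixes I
  assumes I: "lie_ideal I (filt 0)" "I \<subseteq> filt 1"
begin

lemma root_space_roots_of: "root_space (roots_of I) = I"
proof
  show "root_space (roots_of I) \<subseteq> I"
    using root_space_subset[of I "roots_of I"] I by (auto simp: lie_ideal_def roots_of_def)
  show "I \<subseteq> root_space (roots_of I)"
    using el_in_ideal[OF I] supp_filt_1 I(2) by (fastforce simp: root_space_def roots_of_def)
qed

lemma roots_of_br:
  assumes "(i, j) \<in> roots_of I" "p + q \<le> 2 * n" "k < l" "l \<le> 2 * n" "a (br (el p q) (el i j)) k l \<noteq> 0"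
  shows "(k, l) \<in> roots_of I"
proof -
  have br_I: "br (el p q) (el i j) \<in> I"
    using assms(1,2) I(1) el_filt[of p q 0] by (auto simp: lie_ideal_def roots_of_def)
  moreover have "(k, l) \<in> supp (br (el p q) (el i j))" using assms by (simp add: supp_def)
  ultimately show ?thesis
    using el_in_ideal[OF I] supp_filt_1 I(2) by (auto simp: roots_of_def)
qed

text \<open>Here i + 1 < n, and \<open>el i (2 * n - Suc i)\<close> is the root vector of the simple
  root eps_i - eps_(i+1).\<close>

lemma roots_of_step_left:
  assumes "(Suc i, j) \<in> roots_of I"
  shows "(i, j) \<in> roots_of I"
proof (rule roots_of_br[OF assms, of i "2 * n - Suc i"])
  have ij: "Suc i < j" "Suc i + j < 2 * n" using assms by (auto simp: roots_of_def)
  then have "i \<noteq> 2 * n - Suc i" by presburger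
  then show "a (br (el i (2 * n - Suc i)) (el (Suc i) j)) i j \<noteq> 0"
    using ij by (simp add: a_br_el a_el)
qed (use assms in \<open>auto simp: roots_of_def\<close>)

text \<open>The element \<open>el j (2 * n - Suc j)\<close> is, up to sign, a simple root vector:
  its indices add up to 2n - 1.\<close>

lemma roots_of_step_right:
  assumes "(i, Suc j) \<in> roots_of I" "i < j"
  shows "(i, j) \<in> roots_of I"
proof (rule roots_of_br[OF assms(1), of j "2 * n - Suc j"])
  have ij: "i < j" "i + Suc j < 2 * n" using assms by (auto simp: roots_of_def)
  \<comment> \<open>By parity the two indices differ, so the matrix unit does not degenerate to
    zero.\<close>
  then have "j \<noteq> 2 * n - Suc j" by presburger
  then show "a (br (el j (2 * n - Suc j)) (el i (Suc j))) i j \<noteq> 0"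
    using ij by (simp add: a_br_el a_el)
qed (use assms in \<open>auto simp: roots_of_def\<close>)

lemma roots_of_root_ideal: "roots_of I \<in> root_ideals n"
proof -
  have left: "(i - d, j) \<in> roots_of I" if "(i, j) \<in> roots_of I" for i j d
  proof (induction d)
    case (Suc d)
    then show ?case using roots_of_step_left[of "i - Suc d" j] by (cases "i \<le> d") (auto simp: Suc_diff_Suc)
  qed (use that in simp)
  have right: "(i, j - d) \<in> roots_of I" if "(i, j) \<in> roots_of I" "i < j - d" for i j d
    using that(2)
  proof (induction d)
    case (Suc d)
    then show ?case using roots_of_step_right[of i "j - Suc d"] by (auto simp: Suc_diff_Suc)
  qed (use that in simp)
  \<comment> \<open>The first index is lowered first; every intermediate pair then still has its
    first entry below its second.\<close>
  have "(i', j') \<in> roots_of I" if "(i, j) \<in> roots_of I" "i' \<le> i" "j' \<le> j" "i' < j'" for i j i' j'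
    using left[OF that(1), of "i - i'"] right[of i' j "j - j'"] that by auto
  then show ?thesis unfolding root_ideals_def by (auto simp: roots_of_def)
qed

end

theorem bij_betw_root_space:
  "bij_betw root_space (root_ideals n) {I. ad_nilpotent_ideal I (filt 0)}"
proof (rule bij_betwI[where g = roots_of])
  show "root_space \<in> root_ideals n \<rightarrow> {I. ad_nilpotent_ideal I (filt 0)}"
    using root_space_ideal by (auto simp: ad_nilpotent_ideal_iff)
qed (auto simp: ad_nilpotent_ideal_iff roots_of_root_space root_space_roots_of roots_of_root_ideal)

lemma borel_eq_filt:
  assumes "borel_subalgebra b" "\<And>x i j. x \<in> b \<Longrightarrow> i \<le> 2 * n \<Longrightarrow> j \<le> 2 * n \<Longrightarrow> 2 * n < i + j \<Longrightarrow> a x i j = 0"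
  shows "b = filt 0"
proof -
  have "b \<subseteq> filt 0" using assms(2) by (auto simp: filt_def)
  then show ?thesis using assms(1) solvable_filt_0 unfolding borel_subalgebra_def by blast
qed

end

section \<open>Root ideals and paths\<close>

text \<open>The number of letters \<open>F\<close> in the prefix of length \<open>2n + 1 - d\<close> of a path is the number of
  roots \<open>(i, i + d)\<close> in the corresponding ideal.\<close>

definition path_roots :: "nat \<Rightarrow> letter list \<Rightarrow> (nat \<times> nat) set" where
  "path_roots n w = {(i, j). i < j \<and> i < count_list (take (2 * n + 1 - (j - i)) w) F}"

lemma count_R_F: "count_list u R + count_list u F = length u"
proof (induction u)
  case (Cons x u)
  then show ?case by (cases x) auto
qed simp

lemma B_paths_alt:
  "w \<in> B_paths n \<longleftrightarrow> length w = 2 * n \<and> (\<forall>p\<le>2*n. 2 * count_list (take p w) F \<le> p)"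
proof -
  have "(\<forall>u. prefix u w \<longrightarrow> count_list u F \<le> count_list u R) \<longleftrightarrow>
      (\<forall>p\<le>2*n. 2 * count_list (take p w) F \<le> p)" if len: "length w = 2 * n"
  proof
    assume *: "\<forall>u. prefix u w \<longrightarrow> count_list u F \<le> count_list u R"
    show "\<forall>p\<le>2*n. 2 * count_list (take p w) F \<le> p"
    proof (intro allI impI)
      fix p assume "p \<le> 2 * n"
      then show "2 * count_list (take p w) F \<le> p"
        using *[rule_format, OF take_is_prefix, of p] count_R_F[of "take p w"] len by simp
    qed
  next
    assume *: "\<forall>p\<le>2*n. 2 * count_list (take p w) F \<le> p"
    show "\<forall>u. prefix u w \<longrightarrow> count_list u F \<le> count_list u R"
    proof (intro allI impI)
      fix u assume "prefix u w"
      then have "u = take (length u) w" "length u \<le> 2 * n"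
        using len by (auto simp: prefix_def)
      then show "count_list u F \<le> count_list u R"
        using *[rule_format, of "length u"] count_R_F[of u] by simp
    qed
  qed
  then show ?thesis unfolding B_paths_def by auto
qed

lemma count_take_Suc:
  "p < length w \<Longrightarrow> count_list (take (Suc p) w) F = count_list (take p w) F + of_bool (w ! p = F)"
  by (simp add: take_Suc_conv_app_nth)

lemma count_take_mono: "p \<le> q \<Longrightarrow> count_list (take p w) F \<le> count_list (take q w) F"
proof (induction q rule: dec_induct)
  case (step q)
  then show ?case
    using count_take_Suc[of q w] by (cases "q < length w") auto
qed simp

lemma count_take_lipschitz: "count_list (take (p + d) w) F \<le> count_list (take p w) F + d"
proof (induction d)
  case (Suc d)
  then show ?case
    using count_take_Suc[of "p + d" w] by (cases "p + d < length w") auto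
qed simp

text \<open>Let \<open>c d\<close> be the number of roots on the diagonal d. It decreases in d, by
  at most 1 per step. The first fact gives closure when the smaller pair lies on a diagonal with d
  no larger, the second when d grows, since d grows by at most i - i'. The path inequality 2 c(d)
  \<le> 2n + 1 - d is what bounds i + j.\<close>

lemma path_roots_root_ideal:
  assumes "w \<in> B_paths n"
  shows "path_roots n w \<in> root_ideals n"
proof -
  define c where "c d = count_list (take (2 * n + 1 - d) w) F" for d
  have w: "2 * count_list (take p w) F \<le> p" if "p \<le> 2 * n" for p
    using assms that by (simp add: B_paths_alt)
  have c_anti: "c d' \<le> c d" if "d \<le> d'" for d d'
    unfolding c_def by (rule count_take_mono) (use that in auto)
  have c_lip: "c d \<le> c d' + (d' - d)" if "d \<le> d'" for d d'
  proof -
    have "c d \<le> count_list (take (2 * n + 1 - d' + (d' - d)) w) F"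
      unfolding c_def by (rule count_take_mono) (use that in auto)
    also have "\<dots> \<le> c d' + (d' - d)" unfolding c_def by (rule count_take_lipschitz)
    finally show ?thesis .
  qed
  have mem: "(i, j) \<in> path_roots n w \<longleftrightarrow> i < j \<and> i < c (j - i)" for i j
    by (simp add: path_roots_def c_def)
  have sum_less: "i + j < 2 * n" if "i < j" "i < c (j - i)" for i j
  proof -
    have "2 * c (j - i) \<le> 2 * n + 1 - (j - i)" unfolding c_def using that(1) by (intro w) simp
    with that show ?thesis by linarith
  qed
  have down: "i' < c (j' - i')" if "i < j" "i < c (j - i)" "i' \<le> i" "j' \<le> j" "i' < j'" for i j i' j'
  proof (cases "j' - i' \<le> j - i")
    case True
    then show ?thesis using c_anti[OF True] that by linarith
  next
    case False
    then show ?thesis using c_lip[of "j - i" "j' - i'"] that by linarith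
  qed
  show ?thesis
    unfolding root_ideals_def mem_Collect_eq mem
  proof (intro conjI allI impI; elim conjE)
    fix i j i' j' assume "i < j" "i < c (j - i)" "i' \<le> i" "j' \<le> j" "i' < j'"
    then show "i' < c (j' - i')" by (rule down)
  qed (use sum_less in auto)
qed

text \<open>The diagonals are initial segments, so the set determines the number of \<open>F\<close>
  in every prefix, and consecutive counts determine the letters.\<close>

lemma path_roots_inj: "inj_on (path_roots n) (B_paths n)"
proof (rule inj_onI)
  fix v w assume vw: "v \<in> B_paths n" "w \<in> B_paths n" "path_roots n v = path_roots n w"
  have len: "length v = 2 * n" "length w = 2 * n" using vw by (auto simp: B_paths_alt)
  have c: "count_list (take p v) F = count_list (take p w) F" if p: "p \<le> 2 * n" for p
  proof -
    have "i < count_list (take p u) F \<longleftrightarrow> (i, i + (2 * n + 1 - p)) \<in> path_roots n u" for i u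
    proof -
      have "i < i + (2 * n + 1 - p)" "2 * n + 1 - (i + (2 * n + 1 - p) - i) = p" using p by auto
      then show ?thesis by (simp only: path_roots_def mem_Collect_eq case_prod_conv simp_thms)
    qed
    then have "i < count_list (take p v) F \<longleftrightarrow> i < count_list (take p w) F" for i
      using vw(3) by simp
    then show ?thesis by (meson linorder_neqE_nat less_irrefl)
  qed
  show "v = w"
  proof (rule nth_equalityI)
    fix i assume "i < length v"
    then have "(v ! i = F) = (w ! i = F)"
      using c[of i] c[of "Suc i"] count_take_Suc[of i v] count_take_Suc[of i w] len
      by (auto simp: of_bool_def split: if_splits)
    then show "v ! i = w ! i" by (cases "v ! i"; cases "w ! i") auto
  qed (simp add: len)
qed

lemma path_roots_surj:
  assumes "\<Phi> \<in> root_ideals n"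
  shows "\<exists>w\<in>B_paths n. path_roots n w = \<Phi>"
proof -
  have P: "i < j \<and> i + j < 2 * n" if "(i, j) \<in> \<Phi>" for i j
    using assms that by (auto simp: root_ideals_def)
  have down: "(i', j') \<in> \<Phi>" if "(i, j) \<in> \<Phi>" "i' \<le> i" "j' \<le> j" "i' < j'" for i j i' j'
    using assms that unfolding root_ideals_def by blast
  define D where "D p = {i. (i, i + (2 * n + 1 - p)) \<in> \<Phi>}" for p
  define c where "c p = card (D p)" for p
  have fin: "finite (D p)" for p
    by (rule finite_subset[of _ "{..2 * n}"]) (use P in \<open>force simp: D_def\<close>)+
  have D: "i \<in> D p \<longleftrightarrow> i < c p" if "p \<le> 2 * n" for i p
  proof -
    have closed: "i' \<in> D p" if "i \<in> D p" "i' \<le> i" for i i'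
      using that \<open>p \<le> 2 * n\<close> unfolding D_def by (auto intro: down)
    have "D p = {..<c p}"
    proof (cases "D p = {}")
      case False
      then have "D p = {..Max (D p)}"
        using Max_ge[OF fin] closed[OF Max_in[OF fin False]] by auto
      then have "c p = Suc (Max (D p))" unfolding c_def by (metis card_atMost)
      with \<open>D p = {..Max (D p)}\<close> show ?thesis by (simp add: lessThan_Suc_atMost)
    qed (simp add: c_def)
    then show ?thesis by auto
  qed
  have mem: "(i, j) \<in> \<Phi> \<longleftrightarrow> i < j \<and> j - i \<le> 2 * n \<and> i < c (2 * n + 1 - (j - i))" for i j
  proof -
    have "i \<in> D (2 * n + 1 - (j - i)) \<longleftrightarrow> (i, j) \<in> \<Phi>" if "i < j" "j - i \<le> 2 * n"
      using that by (simp add: D_def)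
    moreover have "i < j \<and> j - i \<le> 2 * n" if "(i, j) \<in> \<Phi>" using P[OF that] by auto
    ultimately show ?thesis using D[of "2 * n + 1 - (j - i)" i] by auto
  qed
  \<comment> \<open>The empty prefix corresponds to the diagonal 2n + 1, which contains no
    roots.\<close>
  have c0: "c 0 = 0"
  proof -
    have "i \<notin> D 0" for i using P[of i "i + (2 * n + 1)"] by (auto simp: D_def)
    then have "D 0 = {}" by auto
    then show ?thesis by (simp add: c_def)
  qed
  have c_le: "2 * c p \<le> p" if "p \<le> 2 * n" for p
  proof (cases "c p")
    case (Suc i)
    then have "i \<in> D p" using D[OF that] by simp
    then have "i + (i + (2 * n + 1 - p)) < 2 * n" using P by (auto simp: D_def)
    with Suc that show ?thesis by linarith
  qed simp
  \<comment> \<open>Passing from diagonal d to d - 1, lowering j keeps every i, so the length does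
    not drop. Conversely (i + 1, i + d) lies above (i, i + d), so it grows by at most one.\<close>
  have c_Suc: "c (Suc p) = c p \<or> c (Suc p) = Suc (c p)" if "p < 2 * n" for p
  proof -
    have "c p \<le> c (Suc p)"
    proof (cases "c p")
      case (Suc i)
      then have "i \<in> D p" using D[of p] that by simp
      then have "i \<in> D (Suc p)" using that unfolding D_def by (auto intro: down)
      then show ?thesis using D[of "Suc p"] Suc that by simp
    qed simp
    moreover have "c (Suc p) \<le> Suc (c p)"
    proof (rule ccontr)
      assume "\<not> ?thesis"
      then have "Suc (c p) \<in> D (Suc p)" using D[of "Suc p"] that by simp
      then have "(Suc (c p), Suc (c p) + (2 * n + 1 - Suc p)) \<in> \<Phi>" by (simp add: D_def)
      then have "(c p, c p + (2 * n + 1 - p)) \<in> \<Phi>" by (rule down) (use that in auto)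
      then have "c p \<in> D p" by (simp add: D_def)
      then show False using D[of p] that by simp
    qed
    ultimately show ?thesis by linarith
  qed
  define w where "w = map (\<lambda>p. if c (Suc p) = c p then R else F) [0..<2 * n]"
  have len: "length w = 2 * n" by (simp add: w_def)
  have count: "count_list (take p w) F = c p" if "p \<le> 2 * n" for p
    using that
  proof (induction p)
    case (Suc p)
    have "count_list (take (Suc p) w) F = c p + of_bool (w ! p = F)"
      using Suc len by (simp add: count_take_Suc)
    also have "\<dots> = c (Suc p)" using c_Suc[of p] Suc.prems by (auto simp: w_def)
    finally show ?case .
  qed (simp add: c0)
  have "w \<in> B_paths n" using len count c_le by (simp add: B_paths_alt)
  moreover have "(i, j) \<in> path_roots n w \<longleftrightarrow> (i, j) \<in> \<Phi>" for i j
  proof (cases "i < j \<and> j - i \<le> 2 * n")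
    case True
    then have "count_list (take (2 * n + 1 - (j - i)) w) F = c (2 * n + 1 - (j - i))"
      by (intro count) linarith
    with True show ?thesis unfolding mem path_roots_def by (simp only: mem_Collect_eq case_prod_conv simp_thms)
  next
    case False
    \<comment> \<open>For j - i > 2n the truncated prefix length is 0, so no pair is
      contributed.\<close>
    then have "(i, j) \<notin> path_roots n w" by (auto simp: path_roots_def)
    with False show ?thesis unfolding mem by auto
  qed
  then have "path_roots n w = \<Phi>" by auto
  ultimately show ?thesis by auto
qed

theorem bij_betw_path_roots: "bij_betw (path_roots n) (B_paths n) (root_ideals n)"
  unfolding bij_betw_def
proof
  show "path_roots n ` B_paths n = root_ideals n"
    using path_roots_root_ideal path_roots_surj by (auto simp: image_iff) metis
qed (rule path_roots_inj)

theorem proposition3: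
  fixes n :: nat
    and scale :: "complex \<Rightarrow> 'a::ab_group_add \<Rightarrow> 'a"
    and br :: "'a \<Rightarrow> 'a \<Rightarrow> 'a"
    and b :: "'a set"
  assumes "n \<ge> 2"
    and "complex_lie_algebra scale br"
    and "complex_lie_algebra.simple_lie scale br"
    and "complex_lie_algebra.type_B scale br n"
    and "complex_lie_algebra.borel_subalgebra scale br b"
  shows "\<exists>\<Phi>. bij_betw \<Phi> {I. complex_lie_algebra.ad_nilpotent_ideal scale br I b} (B_paths n)"
proof -
  interpret complex_lie_algebra scale br by fact
  have "solvable_subalgebra b" using assms(5) by (simp add: borel_subalgebra_def)
  from exists_coordinates[OF assms(4) this] obtain a where "so_coordinates scale br n a"
    and upper: "\<forall>x\<in>b. \<forall>i\<le>2*n. \<forall>j\<le>2*n. 2 * n < i + j \<longrightarrow> a x i j = 0"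
    by (elim exE conjE)
  then interpret so_coordinates scale br n a by simp
  have b: "b = filt 0" using assms(5) upper by (intro borel_eq_filt) auto
  \<comment> \<open>The explicit bijection runs from paths to ideals and is inverted at the
    end.\<close>
  have "bij_betw (root_space \<circ> path_roots n) (B_paths n) {I. ad_nilpotent_ideal I b}"
    unfolding b using bij_betw_path_roots bij_betw_root_space by (rule bij_betw_trans)
  then show ?thesis using bij_betw_inv_into by blast
qed

end
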